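(* Assume that $P_{n+1}^-\subseteq P_n^-$ for all $n\in\mathbb Z$. Then the Weyl function $q$ of the symmetric operator $L_{\min}$ in $\mathfrak H_m$ is the sum of the Weyl functions $q^\pm$ of the corresponding symmetric restrictions $L^\pm_{\min}$ in $\mathfrak H_m^\pm$: $$q(z)=q^-(z)+q^+(z)\qquad(z\in\operatorname{res}L).$$
   Context: Inner products are conjugate-linear in the first argument; $\operatorname{res}$ denotes the resolvent set. Let $L$ be a lower semibounded self-adjoint operator in a Hilbert space $\mathfrak H_0$; fix $z_1\in\operatorname{res}L\cap\mathbb R$; $b_n(L):=(L-z_1)^n$. $\mathfrak H_{n+1}\subseteq\mathfrak H_n$ ($n\in\mathbb Z$) is the scale of Hilbert spaces associated with $L$, $\operatorname{dom}L=\mathfrak H_2$, with $\langle f,g\rangle_n:=\langle b_n(L)^{1/2}f,b_n(L)^{1/2}g\rangle_0$ ($\mathfrak H_n=\operatorname{dom}b_n(L)^{1/2}$ for $n\ge0$, completion of $\mathfrak H_0$ for $n<0$). The $b_l(L)^{1/2}$ are regarded as unitary maps $\mathfrak H_k\to\mathfrak H_{k-l}$. $L_n$ is the self-adjoint operator $L$ in $\mathfrak H_n$ with domain $\mathfrak H_{n+2}$. Fix $m,d\in\mathbb N$ and a family of linearly independent functionals $\varphi_\sigma\in\mathfrak H_{-m-2}\setminus\mathfrak H_{-m-1}$, $\sigma$ ranging over a set of $d$ elements. Duality pairing of $\psi\in\mathfrak H_{-m-2}$ with $f\in\mathfrak H_{m+2}$: $\langle\psi,f\rangle:=\langle b_{m+2}(L)^{-1/2}\psi,b_{m+2}(L)^{1/2}f\rangle_0$.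 $L_{\min}$ is the restriction of $L_m$ to $\{f\in\mathfrak H_{m+2}:\langle\varphi_\sigma,f\rangle=0\ \forall\sigma\}$, a densely defined, closed, symmetric operator in $\mathfrak H_m$ with defect numbers $(d,d)$. $h_{\sigma,m+1}:=b_{m+1}(L)^{-1}\varphi_\sigma\in\mathfrak H_m\setminus\mathfrak H_{m+1}$. For each $n$, $P_n^-$ is an orthogonal projection in $\mathfrak H_n$ onto a subspace $\mathfrak H_n^-$, $P_n^+:=I-P_n^-$, with range $\mathfrak H_n^+$; $P_{n+1}^-\subseteq P_n^-$ means $P_n^-f=P_{n+1}^-f$ for $f\in\mathfrak H_{n+1}$. $P_0^\pm(m):=b_m(L)^{1/2}P_m^\pm b_m(L)^{-1/2}$ on $\mathfrak H_0$; $\varphi_\sigma^\pm:=b_{m+2}(L)^{1/2}P_0^\pm(m)b_{m+2}(L)^{-1/2}\varphi_\sigma\in b_{m+2}(L)^{1/2}(\mathfrak H_0^\pm\setminus\mathfrak H_1^\pm)$; $h^\pm_{\sigma,m+1}:=P_m^\pm h_{\sigma,m+1}$. $L_m^\pm$ is the part of $L_m$ in $\mathfrak H_m^\pm$ (domain $\mathfrak H^\pm_{m+2}$), self-adjoint in $\mathfrak H_m^\pm$, with $\operatorname{res}L\subseteq\operatorname{res}L_m^\pm$. $L^\pm_{\min}$ is the restriction of $L^\pm_m$ to $\{f\in\mathfrak H_{m+2}^\pm:\langle\varphi^\pm_\sigma,f\rangle=0\ \forall\sigma\}$. The Weyl functions are the $d\times d$ matrix functions $[q(z)]_{\sigma\sigma'}:=(z-z_1)\langle\varphi_\sigma,(L-z)^{-1}h_{\sigma',m+1}\rangle$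 and $[q^\pm(z)]_{\sigma\sigma'}:=(z-z_1)\langle\varphi^\pm_\sigma,(L^\pm_m-z)^{-1}h^\pm_{\sigma',m+1}\rangle$. They correspond to the boundary triples with boundary space $\mathbb C^d$ for the adjoints of $L_{\min}$ in $\mathfrak H_m$ and of $L^\pm_{\min}$ in $\mathfrak H_m^\pm$ given by the maps $f^\#+\sum_\sigma c_\sigma h_{\sigma,m+1}\mapsto c,\ (\langle\varphi_\sigma,f^\#\rangle)_\sigma$ ($f^\#\in\mathfrak H_{m+2}$, $c\in\mathbb C^d$), respectively $f^{\#\pm}+\sum_\sigma c_\sigma h^\pm_{\sigma,m+1}\mapsto c,\ (\langle\varphi^\pm_\sigma,f^{\#\pm}\rangle)_\sigma$ ($f^{\#\pm}\in\mathfrak H^\pm_{m+2}$, $c\in\mathbb C^d$).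
   Formalization: The real point z_1 in res L is also assumed to be a lower bound of L (L ≥ z_1), so that the square roots b_n(L)^{1/2} are non-negative; for z_1 in a spectral gap the projections need not reduce L and q^± may be undefined. *)

theory Defs
  imports "HOL-Analysis.Finite_Cartesian_Product"
begin

class complex_vector = ab_group_add +
  fixes scaleC :: "complex \<Rightarrow> 'a \<Rightarrow> 'a"  (infixr "*\<^sub>C" 75)
  assumes scaleC_add_right: "a *\<^sub>C (x + y) = a *\<^sub>C x + a *\<^sub>C y"
    and scaleC_add_left: "(a + b) *\<^sub>C x = a *\<^sub>C x + b *\<^sub>C x"
    and scaleC_scaleC: "a *\<^sub>C b *\<^sub>C x = (a * b) *\<^sub>C x"
    and scaleC_one: "1 *\<^sub>C x = x"

global_interpretation complex_vector: vector_space "scaleC :: complex \<Rightarrow> 'a \<Rightarrow> 'a::complex_vector"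
  by standard (rule scaleC_add_right scaleC_add_left scaleC_scaleC scaleC_one)+


section \<open>Hilbert spaces carried by subspaces of a complex vector space\<close>

definition nrm :: "('a \<Rightarrow> 'a \<Rightarrow> complex) \<Rightarrow> 'a \<Rightarrow> real" where
  "nrm ip f = sqrt (Re (ip f f))"

definition lim_in :: "('a::complex_vector \<Rightarrow> 'a \<Rightarrow> complex) \<Rightarrow> (nat \<Rightarrow> 'a) \<Rightarrow> 'a \<Rightarrow> bool" where
  "lim_in ip s f \<longleftrightarrow> (\<lambda>j. nrm ip (s j - f)) \<longlonglongrightarrow> 0"

definition dense_in :: "'a::complex_vector set \<Rightarrow> ('a \<Rightarrow> 'a \<Rightarrow> complex) \<Rightarrow> 'a set \<Rightarrow> bool" where
  "dense_in X ip D \<longleftrightarrow> D \<subseteq> X \<and> (\<forall>f\<in>X. \<exists>s. (\<forall>j. s j \<in> D) \<and> lim_in ip s f)"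

locale hilbert_space =
  fixes X :: "'a::complex_vector set" and ip :: "'a \<Rightarrow> 'a \<Rightarrow> complex"
  assumes subspace: "complex_vector.subspace X"
    and ip_add_right: "\<lbrakk>f \<in> X; g \<in> X; h \<in> X\<rbrakk> \<Longrightarrow> ip f (g + h) = ip f g + ip f h"
    and ip_scale_right: "\<lbrakk>f \<in> X; g \<in> X\<rbrakk> \<Longrightarrow> ip f (c *\<^sub>C g) = c * ip f g"
    and ip_cnj: "\<lbrakk>f \<in> X; g \<in> X\<rbrakk> \<Longrightarrow> ip g f = cnj (ip f g)"
    and ip_pos: "\<lbrakk>f \<in> X; f \<noteq> 0\<rbrakk> \<Longrightarrow> 0 < Re (ip f f)"
    and complete: "\<lbrakk>\<And>j. s j \<in> X; \<And>e. 0 < e \<Longrightarrow> \<exists>N. \<forall>i\<ge>N. \<forall>j\<ge>N. nrm ip (s i - s j) < e\<rbrakk>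
        \<Longrightarrow> \<exists>f\<in>X. lim_in ip s f"

definition orth_proj ::
  "'a::complex_vector set \<Rightarrow> ('a \<Rightarrow> 'a \<Rightarrow> complex) \<Rightarrow> ('a \<Rightarrow> 'a) \<Rightarrow> bool" where
  "orth_proj X ip p \<longleftrightarrow>
     (\<forall>f\<in>X. p f \<in> X) \<and>
     (\<forall>f\<in>X. \<forall>g\<in>X. p (f + g) = p f + p g) \<and>
     (\<forall>c. \<forall>f\<in>X. p (c *\<^sub>C f) = c *\<^sub>C p f) \<and>
     (\<forall>f\<in>X. p (p f) = p f) \<and>
     (\<forall>f\<in>X. \<forall>g\<in>X. ip (p f) g = ip f (p g))"


section \<open>Unbounded operators\<close>

text \<open>Operators are represented by their graphs, so that products, powers, inverses and domains
  are the relational ones.\<close>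

definition app :: "('a \<times> 'b) set \<Rightarrow> 'a \<Rightarrow> 'b" where
  "app A f = (THE g. (f, g) \<in> A)"

definition shift :: "('a::complex_vector \<times> 'a) set \<Rightarrow> complex \<Rightarrow> ('a \<times> 'a) set" where
  "shift A z = {(f, g - z *\<^sub>C f) | f g. (f, g) \<in> A}"

definition adjoint ::
  "'a set \<Rightarrow> ('a \<Rightarrow> 'a \<Rightarrow> complex) \<Rightarrow> ('a \<times> 'a) set \<Rightarrow> ('a \<times> 'a) set" where
  "adjoint X ip A = {(f, g). f \<in> X \<and> g \<in> X \<and> (\<forall>(u, v)\<in>A. ip f v = ip g u)}"

definition selfadjoint ::
  "'a::complex_vector set \<Rightarrow> ('a \<Rightarrow> 'a \<Rightarrow> complex) \<Rightarrow> ('a \<times> 'a) set \<Rightarrow> bool" where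
  "selfadjoint X ip A \<longleftrightarrow>
     A \<subseteq> X \<times> X \<and> single_valued A \<and> dense_in X ip (Domain A) \<and> adjoint X ip A = A"

definition bounded_below_by ::
  "('a \<Rightarrow> 'a \<Rightarrow> complex) \<Rightarrow> real \<Rightarrow> ('a \<times> 'a) set \<Rightarrow> bool" where
  "bounded_below_by ip c A \<longleftrightarrow> (\<forall>(f, g)\<in>A. c * Re (ip f f) \<le> Re (ip f g))"

definition resolvent_set ::
  "'a::complex_vector set \<Rightarrow> ('a \<Rightarrow> 'a \<Rightarrow> complex) \<Rightarrow> ('a \<times> 'a) set \<Rightarrow> complex set" where
  "resolvent_set X ip A =
     {z. (\<forall>g\<in>X. \<exists>!f. (f, g) \<in> shift A z) \<and>
         (\<exists>C. \<forall>(f, g)\<in>shift A z. nrm ip f \<le> C * nrm ip g)}"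

text \<open>The nonnegative self-adjoint square root; it exists and is unique for nonnegative
  self-adjoint \<open>A\<close>.\<close>

definition op_sqrt ::
  "'a::complex_vector set \<Rightarrow> ('a \<Rightarrow> 'a \<Rightarrow> complex) \<Rightarrow> ('a \<times> 'a) set \<Rightarrow> ('a \<times> 'a) set" where
  "op_sqrt X ip A = (THE S. selfadjoint X ip S \<and> bounded_below_by ip 0 S \<and> S O S = A)"


section \<open>The scale of Hilbert spaces associated with a semibounded operator\<close>

text \<open>All spaces of the scale are subspaces of one complex vector space, so that the inclusions
  of the scale are set inclusions.\<close>

record 'a hscale =
  Hsp :: "int \<Rightarrow> 'a set"
  Hip :: "int \<Rightarrow> 'a \<Rightarrow> 'a \<Rightarrow> complex"
  Lop :: "('a \<times> 'a) set"
  base_pt :: real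

definition b_op :: "'a::complex_vector hscale \<Rightarrow> int \<Rightarrow> ('a \<times> 'a) set" where
  "b_op S n = Id_on (Hsp S 0) O
     (if 0 \<le> n then shift (Lop S) (of_real (base_pt S)) ^^ nat n
      else ((shift (Lop S) (of_real (base_pt S)))\<inverse>) ^^ nat (- n))"

definition b_half :: "'a::complex_vector hscale \<Rightarrow> int \<Rightarrow> ('a \<times> 'a) set" where
  "b_half S n = op_sqrt (Hsp S 0) (Hip S 0) (b_op S n)"

text \<open>\<open>b_op S n\<close> is the power \<open>(L - z\<^sub>1)\<^sup>n\<close>; the factor \<open>Id_on\<close> matters only for \<open>n = 0\<close>, where
  the relational power is the identity on the whole type.
  For \<open>n < 0\<close> the space \<open>Hsp S n\<close> is a completion of \<open>Hsp S 0\<close>. Continuity of the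
  inclusions (automatic for \<open>n \<ge> 0\<close>) makes the set inclusions between different completions
  the canonical embeddings. For odd \<open>n\<close> the form of \<open>b_op S n\<close> is an inner product
  only if the base point lies below the spectrum; this is \<open>base_below\<close> together with
  \<open>base_res\<close>.\<close>

locale hilbert_scale =
  fixes S :: "'a::complex_vector hscale"
  assumes hilbert: "hilbert_space (Hsp S n) (Hip S n)"
    and L_selfadjoint: "selfadjoint (Hsp S 0) (Hip S 0) (Lop S)"
    and L_semibounded: "\<exists>c. bounded_below_by (Hip S 0) c (Lop S)"
    and base_res: "of_real (base_pt S) \<in> resolvent_set (Hsp S 0) (Hip S 0) (Lop S)"
    and base_below: "bounded_below_by (Hip S 0) (base_pt S) (Lop S)"
    and incl: "Hsp S (n + 1) \<subseteq> Hsp S n"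
    and incl_continuous: "\<exists>C. \<forall>f\<in>Hsp S (n + 1). nrm (Hip S n) f \<le> C * nrm (Hip S (n + 1)) f"
    and nonneg_space: "0 \<le> n \<Longrightarrow> Hsp S n = Domain (b_half S n)"
    and nonneg_ip: "\<lbrakk>0 \<le> n; f \<in> Hsp S n; g \<in> Hsp S n\<rbrakk> \<Longrightarrow>
          Hip S n f g = Hip S 0 (app (b_half S n) f) (app (b_half S n) g)"
    and neg_dense: "n < 0 \<Longrightarrow> dense_in (Hsp S n) (Hip S n) (Hsp S 0)"
    and neg_ip: "\<lbrakk>n < 0; f \<in> Hsp S 0; g \<in> Hsp S 0\<rbrakk> \<Longrightarrow>
          Hip S n f g = Hip S 0 (app (b_half S n) f) (app (b_half S n) g)"

text \<open>Extension by continuity of an operator \<open>A\<close> to one from \<open>Hsp S k\<close> to \<open>Hsp S l\<close>: the closure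
  of the part of its graph in \<open>Hsp S k \<times> Hsp S l\<close>.\<close>

definition extend ::
  "'a::complex_vector hscale \<Rightarrow> int \<Rightarrow> int \<Rightarrow> ('a \<times> 'a) set \<Rightarrow> ('a \<times> 'a) set" where
  "extend S k l A = {(f, g). f \<in> Hsp S k \<and> g \<in> Hsp S l \<and>
     (\<exists>s t. (\<forall>j. (s j, t j) \<in> A \<inter> Hsp S k \<times> Hsp S l) \<and>
            lim_in (Hip S k) s f \<and> lim_in (Hip S l) t g)}"

text \<open>The unitary map \<open>b\<^sub>l(L)\<^sup>1\<^sup>/\<^sup>2\<close> from \<open>Hsp S k\<close> to \<open>Hsp S (k - l)\<close>.\<close>

definition b_unitary :: "'a::complex_vector hscale \<Rightarrow> int \<Rightarrow> int \<Rightarrow> ('a \<times> 'a) set" where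
  "b_unitary S l k = extend S k (k - l) (b_half S l)"

definition L_on :: "'a::complex_vector hscale \<Rightarrow> nat \<Rightarrow> ('a \<times> 'a) set" where
  "L_on S m = {(f, g) \<in> Lop S. f \<in> Hsp S (int m + 2)}"

definition pairing :: "'a::complex_vector hscale \<Rightarrow> nat \<Rightarrow> 'a \<Rightarrow> 'a \<Rightarrow> complex" where
  "pairing S m \<psi> f =
     Hip S 0 (app ((b_unitary S (int m + 2) 0)\<inverse>) \<psi>) (app (b_unitary S (int m + 2) (int m + 2)) f)"


section \<open>Weyl functions\<close>

definition weyl ::
  "'a::complex_vector hscale \<Rightarrow> nat \<Rightarrow> ('a \<times> 'a) set \<Rightarrow> ('s::finite \<Rightarrow> 'a) \<Rightarrow> ('s \<Rightarrow> 'a) \<Rightarrow>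
   complex \<Rightarrow> complex ^ 's ^ 's" where
  "weyl S m A \<psi> h z = (\<chi> \<sigma> \<sigma>'.
     (z - of_real (base_pt S)) * pairing S m (\<psi> \<sigma>) (app ((shift A z)\<inverse>) (h \<sigma>')))"

definition h_vec :: "'a::complex_vector hscale \<Rightarrow> nat \<Rightarrow> ('s \<Rightarrow> 'a) \<Rightarrow> 's \<Rightarrow> 'a" where
  "h_vec S m \<phi> \<sigma> = app (extend S (- int m - 2) (int m) ((b_op S (int m + 1))\<inverse>)) (\<phi> \<sigma>)"

definition q :: "'a::complex_vector hscale \<Rightarrow> nat \<Rightarrow> ('s::finite \<Rightarrow> 'a) \<Rightarrow> complex \<Rightarrow> complex ^ 's ^ 's" where
  "q S m \<phi> = weyl S m (Lop S) \<phi> (h_vec S m \<phi>)"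

text \<open>In the following \<open>P\<close> stands for either of the two families of projections: the superscript
  minus objects belong to \<open>P\<close> itself and the superscript plus objects to \<open>proj_compl P\<close>.\<close>

definition proj_compl :: "(int \<Rightarrow> 'a::complex_vector \<Rightarrow> 'a) \<Rightarrow> int \<Rightarrow> 'a \<Rightarrow> 'a" where
  "proj_compl P n f = f - P n f"

definition P_zero ::
  "'a::complex_vector hscale \<Rightarrow> nat \<Rightarrow> (int \<Rightarrow> 'a \<Rightarrow> 'a) \<Rightarrow> 'a \<Rightarrow> 'a" where
  "P_zero S m P f =
     app (b_unitary S (int m) (int m)) (P (int m) (app ((b_unitary S (int m) (int m))\<inverse>) f))"

definition phi_part ::
  "'a::complex_vector hscale \<Rightarrow> nat \<Rightarrow> (int \<Rightarrow> 'a \<Rightarrow> 'a) \<Rightarrow> ('s \<Rightarrow> 'a) \<Rightarrow> 's \<Rightarrow> 'a" where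
  "phi_part S m P \<phi> \<sigma> =
     app (b_unitary S (int m + 2) 0) (P_zero S m P (app ((b_unitary S (int m + 2) 0)\<inverse>) (\<phi> \<sigma>)))"

definition L_part ::
  "'a::complex_vector hscale \<Rightarrow> nat \<Rightarrow> (int \<Rightarrow> 'a \<Rightarrow> 'a) \<Rightarrow> ('a \<times> 'a) set" where
  "L_part S m P = L_on S m \<inter> (P (int m) ` Hsp S (int m)) \<times> (P (int m) ` Hsp S (int m))"

definition q_part ::
  "'a::complex_vector hscale \<Rightarrow> nat \<Rightarrow> (int \<Rightarrow> 'a \<Rightarrow> 'a) \<Rightarrow> ('s::finite \<Rightarrow> 'a) \<Rightarrow>
   complex \<Rightarrow> complex ^ 's ^ 's" where
  "q_part S m P \<phi> =
     weyl S m (L_part S m P) (phi_part S m P \<phi>) (\<lambda>\<sigma>. P (int m) (h_vec S m \<phi> \<sigma>))"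

end

(*
  Since base_pt is a real point of the resolvent set below the spectrum, (L - z1)^-1 is a bounded
  positive operator in H_0. Let Q be its positive square root, obtained from the power series of
  sqrt (1 - x); it commutes with every symmetric operator that commutes with (L - z1)^-1. Hence
  b_n(L)^(1/2) is the inverse of Q^n for n >= 0 and H_n = Q^n H_0.

  Comparing the inner products of H_0 and H_1 shows that the projection P_0 commutes with
  (L - z1)^-1, hence with Q, so that P_0(m) = P_0 and the resolvent of the part of L_m applied to
  P_m h is P_0 f, where f = (L - z)^-1 h. Write phi = Q^-(m+2) x and f = Q^(m+2) y with x, y in H_0.
  Then the entries of q, q^- and q^+ are (z - z1) times <x, y>, <x, P_0 y> and <x, y - P_0 y>.
*)
theory Submission
  imports Defs "HOL-Analysis.Infinite_Sum" "HOL-Analysis.Elementary_Metric_Spaces"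
begin

text \<open>\<open>op_sqrt\<close> is a definite description, so \<open>b_half\<close> says nothing
  until existence and uniqueness of the nonnegative self-adjoint root are both established, for the
  bounded powers and for their unbounded inverses. Uniqueness is where the commutation property of Q
  enters: any other root commutes with its own square, hence with Q, and can then be compared with
  it. Inverting graphs carries the unbounded case back to the bounded one. The series of sqrt (1 -
  x) has absolutely summable coefficients, so it may be applied to an operator of norm 1; this
  matters because 0 lies in the spectrum of (L - z1)^-1 whenever L is unbounded. Elements of H_n
  with n < 0 are accessible only through approximation from H_0, so the maps between the spaces are
  controlled as closures of isometric graphs. Finally, x and y do not depend on the projections, and
  the complementary family satisfies the same hypotheses, so a single computation yields both q^-
  and q^+.\<close>

section \<open>The power series of the square root\<close>

text \<open>Coefficients of the power series of \<open>sqrt (1 - x)\<close>.\<close>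

definition sqrt_coeff :: "nat \<Rightarrow> real" where
  "sqrt_coeff k = (- 1) ^ k * ((1 / 2) gchoose k)"

lemma sqrt_coeff_0 [simp]: "sqrt_coeff 0 = 1"
  by (simp add: sqrt_coeff_def)

lemma sqrt_coeff_pochhammer: "sqrt_coeff k = pochhammer (- 1 / 2) k / fact k"
  by (simp add: sqrt_coeff_def gbinomial_pochhammer mult.assoc[symmetric] power_mult_distrib[symmetric])

text \<open>The factors of \<open>pochhammer (- 1 / 2) k\<close> are -1/2, 1/2, 3/2, ...; only the
  first one is negative.\<close>

lemma sqrt_coeff_nonpos: "k \<noteq> 0 \<Longrightarrow> sqrt_coeff k \<le> 0"
proof (cases k)
  case (Suc i)
  have "pochhammer (1 / 2 :: real) i \<ge> 0"
    by (rule pochhammer_nonneg) simp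
  then show ?thesis
    by (simp add: Suc sqrt_coeff_pochhammer pochhammer_rec divide_nonpos_pos mult_nonpos_nonneg del: fact_Suc)
qed simp

text \<open>Partial sums of the coefficients of a power series are the coefficients of its quotient
  by 1 - x. Here that quotient is (1 - x)^(-1/2), all of whose coefficients are positive.\<close>

lemma sum_sqrt_coeff_nonneg: "0 \<le> (\<Sum>k\<le>n. sqrt_coeff k)"
proof -
  have "(\<Sum>k\<le>n. sqrt_coeff k) = (\<Sum>k\<le>n. ((1 / 2) gchoose k) * (- 1) ^ k)"
    by (simp add: sqrt_coeff_def mult.commute)
  also have "\<dots> = (- 1) ^ n * ((- 1 / 2) gchoose n)"
    unfolding gbinomial_sum_lower_neg by simp
  also have "\<dots> = pochhammer (1 / 2) n / fact n"
    by (simp add: gbinomial_pochhammer mult.assoc[symmetric] power_mult_distrib[symmetric])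
  also have "\<dots> \<ge> 0"
    by (intro divide_nonneg_nonneg pochhammer_nonneg) auto
  finally show ?thesis .
qed

text \<open>All coefficients but the first have one sign, so the absolute partial sums equal 2 minus
  the signed ones and never exceed 2. The number 2 is twice the coefficient at 0.\<close>

lemma summable_abs_sqrt_coeff: "summable (\<lambda>k. \<bar>sqrt_coeff k\<bar>)"
proof (rule bounded_imp_summable)
  fix n
  have "\<bar>sqrt_coeff k\<bar> = (if k = 0 then 2 else 0) - sqrt_coeff k" for k
    using sqrt_coeff_nonpos[of k] by auto
  then have "(\<Sum>k\<le>n. \<bar>sqrt_coeff k\<bar>) = 2 - (\<Sum>k\<le>n. sqrt_coeff k)"
    by (simp add: sum_subtractf)
  then show "(\<Sum>k\<le>n. \<bar>sqrt_coeff k\<bar>) \<le> 2"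
    using sum_sqrt_coeff_nonneg[of n] by simp
qed simp

text \<open>Vandermonde's identity with 1/2 + 1/2 = 1: the Cauchy square of the series is 1 -
  x.\<close>

lemma sqrt_coeff_convolution:
  "(\<Sum>i\<le>n. sqrt_coeff i * sqrt_coeff (n - i)) = (if n = 0 then 1 else if n = 1 then - 1 else 0)"
proof -
  have "(\<Sum>i\<le>n. sqrt_coeff i * sqrt_coeff (n - i)) =
      (\<Sum>i\<le>n. (- 1) ^ n * ((1 / 2 gchoose i) * (1 / 2 gchoose (n - i))))"
  proof (rule sum.cong)
    fix i assume "i \<in> {..n}"
    then have "(- 1) ^ i * (- 1) ^ (n - i) = (- 1 :: real) ^ n"
      by (simp add: power_add[symmetric])
    then show "sqrt_coeff i * sqrt_coeff (n - i) = (- 1) ^ n * ((1 / 2 gchoose i) * (1 / 2 gchoose (n - i)))"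
      unfolding sqrt_coeff_def by (metis mult.assoc mult.left_commute)
  qed simp
  also have "\<dots> = (- 1) ^ n * ((1 / 2 + 1 / 2) gchoose n)"
    unfolding gbinomial_Vandermonde[symmetric] sum_distrib_left atLeast0AtMost ..
  also have "(1 / 2 + 1 / 2 :: real) gchoose n = real (1 choose n)"
    using binomial_gbinomial[of 1 n, where 'a = real] by simp
  finally show ?thesis
    by (cases n; cases "n - 1") auto
qed

text \<open>For \<open>a n = \<langle>f, A\<^sup>n g\<rangle>\<close> this says that \<open>\<Sum>\<^sub>k sqrt_coeff k A\<^sup>k\<close> squares to \<open>1 - A\<close>.\<close>

lemma sqrt_coeff_iterated_sum:
  fixes a b :: "nat \<Rightarrow> complex"
  assumes bound: "\<And>n. cmod (a n) \<le> M"
    and inner: "\<And>k. (\<lambda>j. of_real (sqrt_coeff j) * a (j + k)) sums b k"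
    and outer: "(\<lambda>k. of_real (sqrt_coeff k) * b k) sums s"
  shows "s = a 0 - a 1"
proof -
  define F where "F = (\<lambda>(k, j). complex_of_real (sqrt_coeff k) * (of_real (sqrt_coeff j) * a (j + k)))"
  have M: "0 \<le> M"
    using bound[of 0] norm_ge_zero order_trans by blast
  have d: "(\<lambda>k. \<bar>sqrt_coeff k\<bar>) summable_on UNIV"
    using summable_abs_sqrt_coeff by (intro norm_summable_imp_summable_on) simp
  have "(\<lambda>(k, j). \<bar>sqrt_coeff k\<bar> * (\<bar>sqrt_coeff j\<bar> * M)) summable_on UNIV \<times> UNIV"
    by (rule summable_on_SigmaI[where g = "\<lambda>k. \<bar>sqrt_coeff k\<bar> * ((\<Sum>\<^sub>\<infinity>j. \<bar>sqrt_coeff j\<bar>) * M)"])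
      (use M d in \<open>auto intro!: has_sum_cmult_right has_sum_cmult_left summable_on_cmult_left\<close>)
  then have "(\<lambda>x. norm (F x)) summable_on UNIV \<times> UNIV"
    by (rule abs_summable_on_comparison_test')
      (auto simp: F_def norm_mult intro!: mult_left_mono bound)
  then have "F summable_on UNIV \<times> UNIV"
    by (rule abs_summable_summable)
  then obtain t where t: "(F has_sum t) (UNIV \<times> UNIV)"
    by (auto simp: summable_on_def)
  have in_b: "((\<lambda>j. of_real (sqrt_coeff j) * a (j + k)) has_sum b k) UNIV" for k
  proof (rule norm_summable_imp_has_sum[OF _ inner])
    show "summable (\<lambda>j. norm (of_real (sqrt_coeff j) * a (j + k)))"
      by (rule summable_comparison_test[OF _ summable_mult2[OF summable_abs_sqrt_coeff, of M]])
        (auto simp: norm_mult intro!: mult_left_mono bound)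
  qed
  have "((\<lambda>k. of_real (sqrt_coeff k) * b k) has_sum t) UNIV"
    by (rule has_sum_SigmaD[OF t]) (auto simp: F_def intro!: has_sum_cmult_right in_b)
  then have "s = t"
    using outer has_sum_imp_sums sums_unique2 by blast
  \<comment> \<open>The double series is regrouped along the diagonals \<open>n = k + j\<close>, on
    which the value of \<open>a\<close> is constant; absolute convergence permits this. The second
    index of \<open>G\<close> is the outer index \<open>k\<close> of \<open>F\<close>.\<close>
  define G where "G = (\<lambda>(n, i). complex_of_real (sqrt_coeff i * sqrt_coeff (n - i)) * a n)"
  have "(G has_sum t) (SIGMA n:UNIV. {..n}) \<longleftrightarrow> (F has_sum t) (UNIV \<times> UNIV)"
    by (rule has_sum_reindex_bij_witness[where i = "\<lambda>(i, j). (i + j, i)" and j = "\<lambda>(n, i). (i, n - i)"])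
      (auto simp: F_def G_def)
  with t have "(G has_sum t) (SIGMA n:UNIV. {..n})"
    by simp
  then have "((\<lambda>n. \<Sum>i\<le>n. G (n, i)) has_sum t) UNIV"
    by (rule has_sum_SigmaD) auto
  also have "(\<lambda>n. \<Sum>i\<le>n. G (n, i)) = (\<lambda>n. if n \<in> {0, 1} then (if n = 0 then 1 else - 1) * a n else 0)"
  proof
    fix n
    have "(\<Sum>i\<le>n. G (n, i)) = of_real (\<Sum>i\<le>n. sqrt_coeff i * sqrt_coeff (n - i)) * a n"
      by (simp add: G_def sum_distrib_right)
    then show "(\<Sum>i\<le>n. G (n, i)) = (if n \<in> {0, 1} then (if n = 0 then 1 else - 1) * a n else 0)"
      unfolding sqrt_coeff_convolution by auto
  qed
  finally have "(\<lambda>n. if n \<in> {0, 1} then (if n = 0 then 1 else - 1) * a n else 0) sums t"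
    by (rule has_sum_imp_sums)
  then have "t = (\<Sum>n\<in>{0, 1}. (if n = 0 then 1 else - 1) * a n)"
    by (rule sums_unique2) (rule sums_If_finite_set, simp)
  with \<open>s = t\<close> show ?thesis
    by simp
qed

section \<open>Positive operators and their square roots\<close>

lemma dense_in_mono: "dense_in X ip D \<Longrightarrow> D \<subseteq> E \<Longrightarrow> E \<subseteq> X \<Longrightarrow> dense_in X ip E"
  unfolding dense_in_def by (meson subsetD)

section \<open>Inner product and norm\<close>

context hilbert_space
begin

lemma zero_mem [simp]: "0 \<in> X"
  using subspace by (rule complex_vector.subspace_0)

lemma add_mem [intro, simp]: "f \<in> X \<Longrightarrow> g \<in> X \<Longrightarrow> f + g \<in> X"
  using subspace by (rule complex_vector.subspace_add)

lemma scale_mem [intro, simp]: "f \<in> X \<Longrightarrow> c *\<^sub>C f \<in> X"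
  using subspace by (rule complex_vector.subspace_scale)

lemma diff_mem [intro, simp]: "f \<in> X \<Longrightarrow> g \<in> X \<Longrightarrow> f - g \<in> X"
  using subspace by (rule complex_vector.subspace_diff)

lemma sum_mem: "(\<And>k. k \<in> K \<Longrightarrow> s k \<in> X) \<Longrightarrow> sum s K \<in> X"
  using subspace by (rule complex_vector.subspace_sum)

lemma ip_add_left: "\<lbrakk>f \<in> X; g \<in> X; h \<in> X\<rbrakk> \<Longrightarrow> ip (g + h) f = ip g f + ip h f"
  using ip_cnj[of f "g + h"] ip_cnj[of f g] ip_cnj[of f h] ip_add_right[of f g h] by simp

lemma ip_scale_left: "\<lbrakk>f \<in> X; g \<in> X\<rbrakk> \<Longrightarrow> ip (c *\<^sub>C g) f = cnj c * ip g f"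
  using ip_cnj[of f "c *\<^sub>C g"] ip_cnj[of f g] ip_scale_right[of f g c] by simp

lemma ip_diff_right: "\<lbrakk>f \<in> X; g \<in> X; h \<in> X\<rbrakk> \<Longrightarrow> ip f (g - h) = ip f g - ip f h"
  using ip_add_right[of f "g - h" h] by simp

lemma ip_diff_left: "\<lbrakk>f \<in> X; g \<in> X; h \<in> X\<rbrakk> \<Longrightarrow> ip (g - h) f = ip g f - ip h f"
  using ip_add_left[of f "g - h" h] by simp

lemma ip_zero_right [simp]: "f \<in> X \<Longrightarrow> ip f 0 = 0"
  using ip_add_right[of f 0 0] by simp

lemmas ip_simps = ip_add_left ip_add_right ip_diff_left ip_diff_right ip_scale_left ip_scale_right

lemma ip_sum_right:
  "\<lbrakk>finite K; f \<in> X; \<And>k. k \<in> K \<Longrightarrow> s k \<in> X\<rbrakk> \<Longrightarrow> ip f (sum s K) = (\<Sum>k\<in>K. ip f (s k))"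
  by (induction K rule: finite_induct) (auto simp: ip_add_right sum_mem)

lemma ip_self_nonneg: "f \<in> X \<Longrightarrow> 0 \<le> Re (ip f f)"
  using ip_pos[of f] by (cases "f = 0") auto

lemma ip_self_eq: "f \<in> X \<Longrightarrow> ip f f = of_real ((nrm ip f)\<^sup>2)"
proof -
  assume f: "f \<in> X"
  have "Im (ip f f) = Im (cnj (ip f f))"
    using ip_cnj[OF f f] by (rule arg_cong)
  then show ?thesis
    using ip_self_nonneg[OF f] by (simp add: complex_eq_iff nrm_def)
qed

lemma nrm_nonneg [simp]: "f \<in> X \<Longrightarrow> 0 \<le> nrm ip f"
  by (simp add: nrm_def ip_self_nonneg)

lemma nrm_zero [simp]: "nrm ip 0 = 0"
  by (simp add: nrm_def)

lemma nrm_eq_zero: "f \<in> X \<Longrightarrow> nrm ip f = 0 \<longleftrightarrow> f = 0"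
  using ip_pos[of f] by (cases "f = 0") (auto simp: nrm_def)

lemma eq_by_ip:
  assumes "f \<in> X" "g \<in> X" "\<And>h. h \<in> X \<Longrightarrow> ip h f = ip h g"
  shows "f = g"
proof -
  have "ip (f - g) (f - g) = 0"
    using assms by (simp add: ip_diff_right)
  then show ?thesis
    using ip_pos[of "f - g"] assms by fastforce
qed

lemma nrm_minus_commute: "\<lbrakk>f \<in> X; g \<in> X\<rbrakk> \<Longrightarrow> nrm ip (f - g) = nrm ip (g - f)"
  by (simp add: nrm_def ip_simps)

lemma nrm_scale: "f \<in> X \<Longrightarrow> nrm ip (c *\<^sub>C f) = cmod c * nrm ip f"
proof -
  assume f: "f \<in> X"
  have "ip (c *\<^sub>C f) (c *\<^sub>C f) = (c * cnj c) * ip f f"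
    using f by (simp add: ip_simps)
  also have "c * cnj c = of_real ((cmod c)\<^sup>2)"
    by (rule complex_norm_square[symmetric])
  finally show ?thesis
    by (simp add: nrm_def real_sqrt_mult)
qed

section \<open>Symmetric and positive operators defined everywhere\<close>

text \<open>Symmetric maps defined on the whole space are automatically linear.\<close>

definition sym_op :: "('a \<Rightarrow> 'a) \<Rightarrow> bool" where
  "sym_op T \<longleftrightarrow> (\<forall>f\<in>X. T f \<in> X) \<and> (\<forall>f\<in>X. \<forall>g\<in>X. ip (T f) g = ip f (T g))"

definition pos_op :: "('a \<Rightarrow> 'a) \<Rightarrow> bool" where
  "pos_op T \<longleftrightarrow> sym_op T \<and> (\<forall>f\<in>X. 0 \<le> Re (ip f (T f)))"

definition bounded_op :: "('a \<Rightarrow> 'a) \<Rightarrow> bool" where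
  "bounded_op T \<longleftrightarrow> (\<exists>C. \<forall>f\<in>X. nrm ip (T f) \<le> C * nrm ip f)"

definition commute :: "('a \<Rightarrow> 'a) \<Rightarrow> ('a \<Rightarrow> 'a) \<Rightarrow> bool" where
  "commute T U \<longleftrightarrow> (\<forall>f\<in>X. T (U f) = U (T f))"

lemma sym_op_mem: "sym_op T \<Longrightarrow> f \<in> X \<Longrightarrow> T f \<in> X"
  by (simp add: sym_op_def)

lemma sym_opD: "\<lbrakk>sym_op T; f \<in> X; g \<in> X\<rbrakk> \<Longrightarrow> ip (T f) g = ip f (T g)"
  by (simp add: sym_op_def)

lemma pos_op_sym [intro, simp]: "pos_op T \<Longrightarrow> sym_op T"
  by (simp add: pos_op_def)

lemma pos_opD: "pos_op T \<Longrightarrow> f \<in> X \<Longrightarrow> 0 \<le> Re (ip f (T f))"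
  by (simp add: pos_op_def)

lemma sym_op_add: "\<lbrakk>sym_op T; f \<in> X; g \<in> X\<rbrakk> \<Longrightarrow> T (f + g) = T f + T g"
  by (rule eq_by_ip) (auto simp: ip_simps sym_opD[of T, symmetric] sym_op_mem[of T])

lemma sym_op_diff: "\<lbrakk>sym_op T; f \<in> X; g \<in> X\<rbrakk> \<Longrightarrow> T (f - g) = T f - T g"
  by (rule eq_by_ip) (auto simp: ip_simps sym_opD[of T, symmetric] sym_op_mem[of T])

lemma sym_op_scale: "\<lbrakk>sym_op T; f \<in> X\<rbrakk> \<Longrightarrow> T (c *\<^sub>C f) = c *\<^sub>C T f"
  by (rule eq_by_ip) (auto simp: ip_simps sym_opD[of T, symmetric] sym_op_mem[of T])

lemma sym_op_funpow: "sym_op T \<Longrightarrow> sym_op (T ^^ n)"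
proof (induction n)
  case 0
  then show ?case by (simp add: sym_op_def)
next
  case (Suc n)
  have "ip (T ((T ^^ n) f)) g = ip f (T ((T ^^ n) g))" if "f \<in> X" "g \<in> X" for f g
  proof -
    have "ip (T ((T ^^ n) f)) g = ip f ((T ^^ n) (T g))"
      using Suc that by (simp add: sym_opD[of T] sym_opD[of "T ^^ n"] sym_op_mem)
    then show ?thesis
      by (simp add: funpow_swap1)
  qed
  then show ?case
    using Suc sym_op_mem[of T] sym_op_mem[of "T ^^ n"] by (simp add: sym_op_def)
qed

lemma pos_op_id: "pos_op (\<lambda>f. f)"
  by (simp add: pos_op_def sym_op_def ip_self_nonneg)

text \<open>This is the inequality for the semidefinite form \<open>ip f (T g)\<close>. The form is
  nonnegative at \<open>f + c g\<close>; the phase of \<open>c\<close> is chosen so that the cross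
  term becomes real and negative, which leaves a quadratic inequality in the real parameter
  \<open>t\<close>.\<close>

lemma pos_op_Cauchy_Schwarz:
  assumes T: "pos_op T" and f: "f \<in> X" and g: "g \<in> X"
  shows "(cmod (ip f (T g)))\<^sup>2 \<le> Re (ip f (T f)) * Re (ip g (T g))"
proof -
  define \<alpha> a b where "\<alpha> = ip f (T g)" and "a = Re (ip f (T f))" and "b = Re (ip g (T g))"
  have S: "sym_op T" using T by simp
  have gf: "ip g (T f) = cnj \<alpha>"
    using ip_cnj[of f "T g"] f g sym_op_mem[OF S] sym_opD[OF S g f]
    by (simp add: \<alpha>_def)
  have main: "0 \<le> a - 2 * t * (cmod \<alpha>)\<^sup>2 + t\<^sup>2 * (cmod \<alpha>)\<^sup>2 * b" for t :: real
  proof -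
    define c where "c = - of_real t * cnj \<alpha>"
    have "ip (f + c *\<^sub>C g) (T (f + c *\<^sub>C g)) =
        ip f (T f) + (c * \<alpha> + cnj (c * \<alpha>)) + (c * cnj c) * ip g (T g)"
      using f g S sym_op_mem[OF S] by (simp add: sym_op_add sym_op_scale ip_simps gf \<alpha>_def[symmetric] algebra_simps)
    also have "c * \<alpha> = of_real (- t * (cmod \<alpha>)\<^sup>2)"
      unfolding c_def of_real_mult complex_norm_square by (simp add: algebra_simps)
    also have "c * cnj c = of_real (t\<^sup>2 * (cmod \<alpha>)\<^sup>2)"
      unfolding c_def of_real_mult complex_norm_square by (simp add: algebra_simps power2_eq_square)
    finally have "Re (ip (f + c *\<^sub>C g) (T (f + c *\<^sub>C g))) =
        a - 2 * t * (cmod \<alpha>)\<^sup>2 + t\<^sup>2 * (cmod \<alpha>)\<^sup>2 * b"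
      by (simp add: a_def b_def)
    then show ?thesis
      using pos_opD[OF T, of "f + c *\<^sub>C g"] f g by simp
  qed
  have b: "0 \<le> b" "0 \<le> a"
    using pos_opD[OF T] f g by (auto simp: a_def b_def)
  have "(cmod \<alpha>)\<^sup>2 \<le> a * b"
  proof (cases "b = 0")
    case True
    have "\<alpha> = 0"
    proof (rule ccontr)
      assume "\<alpha> \<noteq> 0"
      then have "(cmod \<alpha>)\<^sup>2 > 0" by simp
      \<comment> \<open>For \<open>b = 0\<close> the inequality is linear in \<open>t\<close>, and
        this value of \<open>t\<close> makes its right-hand side -1.\<close>
      then have "2 * ((a + 1) / (2 * (cmod \<alpha>)\<^sup>2)) * (cmod \<alpha>)\<^sup>2 = a + 1"
        by simp
      then show False
        using main[of "(a + 1) / (2 * (cmod \<alpha>)\<^sup>2)"] True by simp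
    qed
    then show ?thesis using True by simp
  next
    case False
    with b have "b > 0" by simp
    \<comment> \<open>The quadratic polynomial in \<open>t\<close> attains its minimum at
      \<open>t = 1 / b\<close>.\<close>
    then have "a - 2 * (1 / b) * (cmod \<alpha>)\<^sup>2 + (1 / b)\<^sup>2 * (cmod \<alpha>)\<^sup>2 * b = a - (cmod \<alpha>)\<^sup>2 / b"
      by (simp add: power2_eq_square)
    then have "0 \<le> a - (cmod \<alpha>)\<^sup>2 / b"
      using main[of "1 / b"] by simp
    then show ?thesis
      using \<open>b > 0\<close> by (simp add: field_simps)
  qed
  then show ?thesis by (simp add: \<alpha>_def a_def b_def)
qed

lemma Cauchy_Schwarz: "\<lbrakk>f \<in> X; g \<in> X\<rbrakk> \<Longrightarrow> cmod (ip f g) \<le> nrm ip f * nrm ip g"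
  using pos_op_Cauchy_Schwarz[OF pos_op_id, of f g]
  by (intro power2_le_imp_le[of "cmod _"]) (simp_all add: power_mult_distrib ip_self_eq)

text \<open>Cauchy-Schwarz for the form of \<open>T\<close> makes \<open>T f\<close> orthogonal to
  every vector.\<close>

lemma pos_op_eq_zero:
  assumes T: "pos_op T" and f: "f \<in> X" and "Re (ip f (T f)) = 0"
  shows "T f = 0"
proof -
  have "(cmod (ip g (T f)))\<^sup>2 \<le> 0" if "g \<in> X" for g
    using pos_op_Cauchy_Schwarz[OF T that f] assms by simp
  then show ?thesis
    using f T sym_op_mem[of T] by (intro eq_by_ip) auto
qed

lemma nrm_triangle: "\<lbrakk>f \<in> X; g \<in> X\<rbrakk> \<Longrightarrow> nrm ip (f + g) \<le> nrm ip f + nrm ip g"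
proof (rule power2_le_imp_le)
  assume f: "f \<in> X" and g: "g \<in> X"
  have "ip (f + g) (f + g) = ip f f + (ip f g + cnj (ip f g)) + ip g g"
    using f g by (simp add: ip_simps ip_cnj[of f g])
  then have "Re (ip (f + g) (f + g)) = Re (ip f f) + 2 * Re (ip f g) + Re (ip g g)"
    by simp
  then have "(nrm ip (f + g))\<^sup>2 = (nrm ip f)\<^sup>2 + 2 * Re (ip f g) + (nrm ip g)\<^sup>2"
    using f g by (simp only: ip_self_eq add_mem Re_complex_of_real)
  also have "Re (ip f g) \<le> nrm ip f * nrm ip g"
    using Cauchy_Schwarz[OF f g] complex_Re_le_cmod[of "ip f g"] by linarith
  finally show "(nrm ip (f + g))\<^sup>2 \<le> (nrm ip f + nrm ip g)\<^sup>2"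
    by (simp add: power2_sum algebra_simps)
qed (auto intro: add_nonneg_nonneg)

lemma nrm_diff_triangle:
  "\<lbrakk>f \<in> X; g \<in> X; h \<in> X\<rbrakk> \<Longrightarrow> nrm ip (f - h) \<le> nrm ip (f - g) + nrm ip (g - h)"
  using nrm_triangle[of "f - g" "g - h"] by simp

lemma nrm_sum_le:
  "\<lbrakk>finite K; \<And>k. k \<in> K \<Longrightarrow> s k \<in> X\<rbrakk> \<Longrightarrow> nrm ip (sum s K) \<le> (\<Sum>k\<in>K. nrm ip (s k))"
proof (induction K rule: finite_induct)
  case (insert k K)
  have "s k \<in> X" "sum s K \<in> X"
    using insert.prems by (simp_all add: sum_mem)
  then have "nrm ip (s k + sum s K) \<le> nrm ip (s k) + nrm ip (sum s K)"
    by (rule nrm_triangle)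
  also have "\<dots> \<le> nrm ip (s k) + (\<Sum>k\<in>K. nrm ip (s k))"
    using insert.IH insert.prems by simp
  finally show ?case
    using insert.hyps by simp
qed simp

section \<open>Limits and Cauchy sequences\<close>

lemma lim_const: "f \<in> X \<Longrightarrow> lim_in ip (\<lambda>_. f) f"
  by (simp add: lim_in_def)

lemma lim_unique:
  assumes "lim_in ip s f" "lim_in ip s g" "\<And>j. s j \<in> X" "f \<in> X" "g \<in> X"
  shows "f = g"
proof -
  have "(\<lambda>j. nrm ip (s j - f) + nrm ip (s j - g)) \<longlonglongrightarrow> 0 + 0"
    using assms(1,2)[unfolded lim_in_def] by (rule tendsto_add)
  note lower = LIMSEQ_le_const[OF this, of "nrm ip (f - g)"]
  have "nrm ip (f - g) \<le> nrm ip (s j - f) + nrm ip (s j - g)" for j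
    using nrm_diff_triangle[of f "s j" g] nrm_minus_commute[of f "s j"] assms(3-5) by simp
  with lower have "nrm ip (f - g) \<le> 0 + 0"
    by blast
  then have "nrm ip (f - g) = 0"
    using nrm_nonneg[OF diff_mem[OF assms(4,5)]] by linarith
  then show ?thesis
    using nrm_eq_zero[of "f - g"] assms(4,5) by simp
qed

lemma lim_ip_right:
  assumes "lim_in ip s g" "\<And>j. s j \<in> X" "f \<in> X" "g \<in> X"
  shows "(\<lambda>j. ip f (s j)) \<longlonglongrightarrow> ip f g"
proof -
  have "norm (ip f (s j) - ip f g) \<le> norm (nrm ip (s j - g)) * nrm ip f" for j
    using Cauchy_Schwarz[of f "s j - g"] assms(2-4) by (simp add: ip_diff_right mult.commute)
  then have "(\<lambda>j. ip f (s j) - ip f g) \<longlonglongrightarrow> 0"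
    by (intro tendsto_0_le[OF assms(1)[unfolded lim_in_def]] always_eventually allI)
  then show ?thesis
    by (simp add: LIM_zero_iff)
qed

lemma lim_imp_Cauchy:
  assumes "lim_in ip s f" "\<And>j. s j \<in> X" "f \<in> X" "0 < e"
  shows "\<exists>N. \<forall>i\<ge>N. \<forall>j\<ge>N. nrm ip (s i - s j) < e"
proof -
  obtain N where N: "\<And>j. j \<ge> N \<Longrightarrow> nrm ip (s j - f) < e / 2"
    using order_tendstoD(2)[OF assms(1)[unfolded lim_in_def], of "e / 2"] assms(4)
    by (auto simp: eventually_sequentially)
  have "nrm ip (s i - s j) < e" if "i \<ge> N" "j \<ge> N" for i j
    using nrm_diff_triangle[of "s i" f "s j"] nrm_minus_commute[of f "s j"] N[OF that(1)] N[OF that(2)] assms(2,3)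
    by simp
  then show ?thesis by blast
qed

section \<open>Square roots of bounded positive operators\<close>

lemma contraction_funpow:
  assumes A: "sym_op A" and le: "\<And>f. f \<in> X \<Longrightarrow> nrm ip (A f) \<le> nrm ip f" and g: "g \<in> X"
  shows "nrm ip ((A ^^ k) g) \<le> nrm ip g"
proof (induction k)
  case (Suc k)
  then show ?case
    using le[of "(A ^^ k) g"] sym_op_mem[OF sym_op_funpow[OF A] g, of k] by simp
qed simp

text \<open>The partial sums converge in norm by completeness and absolute summability. Only the
  scalar series against test vectors is recorded, because it already determines \<open>h\<close> and
  reduces later arguments to series of complex numbers.\<close>

lemma ex_sqrt_one_minus_weak:
  assumes A: "sym_op A" and le: "\<And>f. f \<in> X \<Longrightarrow> nrm ip (A f) \<le> nrm ip f" and g: "g \<in> X"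
  shows "\<exists>h\<in>X. \<forall>f\<in>X. (\<lambda>k. of_real (sqrt_coeff k) * ip f ((A ^^ k) g)) sums ip f h"
proof -
  define t where "t k = complex_of_real (sqrt_coeff k) *\<^sub>C (A ^^ k) g" for k
  define s where "s n = sum t {..<n}" for n
  have Ag: "(A ^^ k) g \<in> X" for k
    using sym_op_mem[OF sym_op_funpow[OF A] g] .
  have t: "t k \<in> X" for k
    using Ag by (simp add: t_def)
  have s: "s n \<in> X" for n
    using t by (simp add: s_def sum_mem)
  have nrm_t: "nrm ip (t k) \<le> \<bar>sqrt_coeff k\<bar> * nrm ip g" for k
    using Ag contraction_funpow[OF A le g] by (simp add: t_def nrm_scale mult_left_mono)
  have Cauchy: "\<exists>N. \<forall>i\<ge>N. \<forall>j\<ge>N. nrm ip (s i - s j) < e" if "0 < e" for e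
  proof -
    have "summable (\<lambda>k. \<bar>sqrt_coeff k\<bar> * nrm ip g)"
      using summable_abs_sqrt_coeff by (rule summable_mult2)
    then obtain N where N: "\<And>i j. i \<ge> N \<Longrightarrow> norm (\<Sum>k\<in>{i..<j}. \<bar>sqrt_coeff k\<bar> * nrm ip g) < e"
      using \<open>0 < e\<close> unfolding summable_Cauchy by blast
    have tail: "nrm ip (s j - s i) < e" if "N \<le> i" "i \<le> j" for i j
    proof -
      have "s j - s i = sum t {i..<j}"
        unfolding s_def lessThan_atLeast0 using sum_diff_nat_ivl[of 0 i j t] that by simp
      also have "nrm ip \<dots> \<le> (\<Sum>k\<in>{i..<j}. nrm ip (t k))"
        using t by (intro nrm_sum_le) auto
      also have "\<dots> \<le> (\<Sum>k\<in>{i..<j}. \<bar>sqrt_coeff k\<bar> * nrm ip g)"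
        by (intro sum_mono nrm_t)
      also have "\<dots> < e"
        using N[OF \<open>N \<le> i\<close>, of j] by simp
      finally show ?thesis .
    qed
    have "nrm ip (s i - s j) < e" if "N \<le> i" "N \<le> j" for i j
      using tail[of i j] tail[of j i] nrm_minus_commute[OF s s, of i j] that by (cases "i \<le> j") auto
    then show ?thesis
      by blast
  qed
  obtain h where h: "h \<in> X" "lim_in ip s h"
    using complete[of s, OF s Cauchy] by blast
  have "(\<lambda>k. of_real (sqrt_coeff k) * ip f ((A ^^ k) g)) sums ip f h" if f: "f \<in> X" for f
  proof -
    have "ip f (s n) = (\<Sum>k<n. of_real (sqrt_coeff k) * ip f ((A ^^ k) g))" for n
      unfolding s_def t_def using f Ag by (subst ip_sum_right) (auto simp: ip_scale_right)
    then show ?thesis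
      using lim_ip_right[OF h(2) s f h(1)] by (simp add: sums_def)
  qed
  with h show ?thesis
    by blast
qed

text \<open>Each property of \<open>Q\<close> is read off the scalar series: symmetry from the real
  coefficients, the square from the double series, commutation by moving the symmetric
  \<open>T\<close> to the other argument term by term, so that no limit is taken under
  \<open>T\<close>.\<close>

lemma ex_sqrt_one_minus:
  assumes A: "sym_op A" and le: "\<And>f. f \<in> X \<Longrightarrow> nrm ip (A f) \<le> nrm ip f"
  obtains Q where "pos_op Q" "\<And>f. f \<in> X \<Longrightarrow> Q (Q f) = f - A f"
    "\<And>T. sym_op T \<Longrightarrow> commute T A \<Longrightarrow> commute T Q"
proof -
  have "\<forall>g\<in>X. \<exists>h. h \<in> X \<and> (\<forall>f\<in>X. (\<lambda>k. of_real (sqrt_coeff k) * ip f ((A ^^ k) g)) sums ip f h)"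
    using ex_sqrt_one_minus_weak[OF assms] by blast
  then obtain Q where Q_mem: "\<And>g. g \<in> X \<Longrightarrow> Q g \<in> X"
    and Q: "\<And>f g. f \<in> X \<Longrightarrow> g \<in> X \<Longrightarrow> (\<lambda>k. of_real (sqrt_coeff k) * ip f ((A ^^ k) g)) sums ip f (Q g)"
    by metis
  have pow_mem: "(A ^^ k) g \<in> X" if "g \<in> X" for k g
    using sym_op_mem[OF sym_op_funpow[OF A] that] .
  have pow_sym: "ip ((A ^^ k) f) g = ip f ((A ^^ k) g)" if "f \<in> X" "g \<in> X" for k f g
    using sym_opD[OF sym_op_funpow[OF A] that] .
  have sym: "sym_op Q"
    unfolding sym_op_def
  proof (intro conjI ballI)
    fix f g assume f: "f \<in> X" and g: "g \<in> X"
    have "(\<lambda>k. cnj (of_real (sqrt_coeff k) * ip g ((A ^^ k) f))) sums cnj (ip g (Q f))"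
      using Q[OF g f] by (simp only: sums_cnj)
    moreover have "cnj (ip g ((A ^^ k) f)) = ip f ((A ^^ k) g)" for k
      using ip_cnj[OF g pow_mem[OF f]] f g by (simp add: pow_sym)
    moreover have "cnj (ip g (Q f)) = ip (Q f) g"
      using ip_cnj[OF g Q_mem[OF f]] by simp
    ultimately have "(\<lambda>k. of_real (sqrt_coeff k) * ip f ((A ^^ k) g)) sums ip (Q f) g"
      by simp
    then show "ip (Q f) g = ip f (Q g)"
      using Q[OF f g] by (rule sums_unique2)
  qed (rule Q_mem)
  have pos: "0 \<le> Re (ip g (Q g))" if g: "g \<in> X" for g
  proof (rule LIMSEQ_le_const)
    show "(\<lambda>n. \<Sum>k\<le>n. Re (of_real (sqrt_coeff k) * ip g ((A ^^ k) g))) \<longlonglongrightarrow> Re (ip g (Q g))"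
      using sums_Re[OF Q[OF g g]] unfolding sums_def_le .
    \<comment> \<open>The coefficients with \<open>k > 0\<close> are nonpositive, so an upper bound
      of \<open>ip g ((A ^^ k) g)\<close> gives a lower bound of the term. The lower bounds add up
      to a nonnegative partial sum times the squared norm.\<close>
    have summand: "sqrt_coeff k * (nrm ip g)\<^sup>2 \<le> Re (of_real (sqrt_coeff k) * ip g ((A ^^ k) g))" for k
    proof (cases "k = 0")
      case True
      then show ?thesis
        using g by (simp add: ip_self_eq)
    next
      case False
      have "Re (ip g ((A ^^ k) g)) \<le> nrm ip g * nrm ip ((A ^^ k) g)"
        using Cauchy_Schwarz[OF g pow_mem[OF g], of k] complex_Re_le_cmod order_trans by blast
      also have "\<dots> \<le> nrm ip g * nrm ip g"
        using contraction_funpow[OF A le g] g by (intro mult_left_mono) auto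
      finally show ?thesis
        using sqrt_coeff_nonpos[OF False] by (simp add: power2_eq_square mult_left_mono_neg)
    qed
    have "0 \<le> (\<Sum>k\<le>n. Re (of_real (sqrt_coeff k) * ip g ((A ^^ k) g)))" for n
    proof -
      have "0 \<le> (\<Sum>k\<le>n. sqrt_coeff k) * (nrm ip g)\<^sup>2"
        using sum_sqrt_coeff_nonneg by simp
      also have "\<dots> \<le> (\<Sum>k\<le>n. Re (of_real (sqrt_coeff k) * ip g ((A ^^ k) g)))"
        unfolding sum_distrib_right by (intro sum_mono summand)
      finally show ?thesis .
    qed
    then show "\<exists>N. \<forall>n\<ge>N. 0 \<le> (\<Sum>k\<le>n. Re (of_real (sqrt_coeff k) * ip g ((A ^^ k) g)))"
      by blast
  qed
  have square: "Q (Q g) = g - A g" if g: "g \<in> X" for g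
  proof (rule eq_by_ip)
    fix f assume f: "f \<in> X"
    \<comment> \<open>Here \<open>a n\<close> is \<open>ip f ((A ^^ n) g)\<close> and
      \<open>b k\<close> is \<open>ip f (Q ((A ^^ k) g))\<close>; the outer series is that of
      \<open>Q g\<close> tested against \<open>Q f\<close>.\<close>
    have "ip f (Q (Q g)) = ip f ((A ^^ 0) g) - ip f ((A ^^ 1) g)"
    proof (rule sqrt_coeff_iterated_sum)
      show "cmod (ip f ((A ^^ n) g)) \<le> nrm ip f * nrm ip g" for n
        using Cauchy_Schwarz[OF f pow_mem[OF g], of n]
          mult_left_mono[OF contraction_funpow[OF A le g, of n] nrm_nonneg[OF f]] by linarith
      show "(\<lambda>j. of_real (sqrt_coeff j) * ip f ((A ^^ (j + k)) g)) sums ip f (Q ((A ^^ k) g))" for k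
        using Q[OF f pow_mem[OF g, of k]] by (simp add: funpow_add)
      have "ip f (Q ((A ^^ k) g)) = ip (Q f) ((A ^^ k) g)" for k
        using sym_opD[OF sym f pow_mem[OF g]] by simp
      then show "(\<lambda>k. of_real (sqrt_coeff k) * ip f (Q ((A ^^ k) g))) sums ip f (Q (Q g))"
        using Q[OF Q_mem[OF f] g] sym_opD[OF sym f Q_mem[OF g]] by simp
    qed
    then show "ip f (Q (Q g)) = ip f (g - A g)"
      using f g sym_op_mem[OF A] by (simp add: ip_diff_right)
  qed (use Q_mem g sym_op_mem[OF A] in auto)
  have comm: "commute T Q" if T: "sym_op T" and TA: "commute T A" for T
    unfolding commute_def
  proof
    fix g assume g: "g \<in> X"
    have Tpow: "T ((A ^^ k) g) = (A ^^ k) (T g)" for k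
      using TA g pow_mem[OF g] by (induction k) (simp_all add: commute_def)
    show "T (Q g) = Q (T g)"
    proof (rule eq_by_ip)
      fix f assume f: "f \<in> X"
      have "ip (T f) ((A ^^ k) g) = ip f ((A ^^ k) (T g))" for k
        using sym_opD[OF T f pow_mem[OF g, of k]] by (simp add: Tpow)
      then have "(\<lambda>k. of_real (sqrt_coeff k) * ip f ((A ^^ k) (T g))) sums ip (T f) (Q g)"
        using Q[OF sym_op_mem[OF T f] g] by simp
      then have "ip (T f) (Q g) = ip f (Q (T g))"
        using Q[OF f sym_op_mem[OF T g]] by (rule sums_unique2)
      then show "ip f (T (Q g)) = ip f (Q (T g))"
        using sym_opD[OF T f Q_mem[OF g]] by simp
    qed (use Q_mem sym_op_mem[OF T] g in auto)
  qed
  show thesis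
    using that[of Q] sym pos square comm unfolding pos_op_def by blast
qed

text \<open>After rescaling, \<open>A = 1 - R / C\<close> is a positive contraction. Its series
  gives a root of \<open>R / C\<close>, and the factor \<open>sqrt C\<close> turns this into a root
  of \<open>R\<close>.\<close>

theorem ex_pos_sqrt:
  assumes R: "pos_op R" and "bounded_op R"
  obtains Q where "pos_op Q" "\<And>f. f \<in> X \<Longrightarrow> Q (Q f) = R f"
    "\<And>T. sym_op T \<Longrightarrow> commute T R \<Longrightarrow> commute T Q"
proof -
  obtain C0 where C0: "\<And>f. f \<in> X \<Longrightarrow> nrm ip (R f) \<le> C0 * nrm ip f"
    using \<open>bounded_op R\<close> by (auto simp: bounded_op_def)
  \<comment> \<open>The bound \<open>C0\<close> may fail to be positive; the maximum with 1 makes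
    division by \<open>C\<close> legitimate.\<close>
  define C where "C = max C0 1"
  have C: "C > 0"
    by (simp add: C_def)
  have R_le: "nrm ip (R f) \<le> C * nrm ip f" if "f \<in> X" for f
  proof -
    have "C0 * nrm ip f \<le> C * nrm ip f"
      using that by (intro mult_right_mono) (auto simp: C_def)
    then show ?thesis
      using C0[OF that] by linarith
  qed
  have R_mem: "R f \<in> X" if "f \<in> X" for f
    using sym_op_mem[OF pos_op_sym[OF R] that] .
  have R_sym: "ip (R f) g = ip f (R g)" if "f \<in> X" "g \<in> X" for f g
    using sym_opD[OF pos_op_sym[OF R] that] .
  define A where "A f = f - complex_of_real (1 / C) *\<^sub>C R f" for f
  have A: "sym_op A"
    using R_mem R_sym by (auto simp: sym_op_def A_def ip_simps)
  have ip_A: "Re (ip f (A f)) = (nrm ip f)\<^sup>2 - Re (ip f (R f)) / C" if "f \<in> X" for f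
    using that R_mem by (simp add: A_def ip_simps ip_self_eq)
  have A_pos: "pos_op A"
  proof -
    have "0 \<le> Re (ip f (A f))" if f: "f \<in> X" for f
    proof -
      have "Re (ip f (R f)) \<le> nrm ip f * nrm ip (R f)"
        using Cauchy_Schwarz[OF f R_mem[OF f]] complex_Re_le_cmod order_trans by blast
      also have "\<dots> \<le> nrm ip f * (C * nrm ip f)"
        using R_le[OF f] f by (intro mult_left_mono) auto
      finally have "Re (ip f (R f)) / C \<le> (nrm ip f)\<^sup>2"
        using C by (simp add: pos_divide_le_eq power2_eq_square mult.commute mult.left_commute)
      then show ?thesis
        using ip_A[OF f] by simp
    qed
    with A show ?thesis
      by (simp add: pos_op_def)
  qed
  have A_form: "Re (ip f (A f)) \<le> (nrm ip f)\<^sup>2" if "f \<in> X" for f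
    using ip_A[OF that] pos_opD[OF R that] C by simp
  have A_le: "nrm ip (A f) \<le> nrm ip f" if f: "f \<in> X" for f
  proof -
    have Af: "A f \<in> X"
      using sym_op_mem[OF A f] .
    \<comment> \<open>A bound on the form becomes a bound on the norm: Cauchy-Schwarz for the form
      of \<open>A\<close> shows that the fourth power of the norm of \<open>A f\<close> is at most
      the product of the squared norms of \<open>A f\<close> and \<open>f\<close>.\<close>
    have "(cmod (ip (A f) (A f)))\<^sup>2 \<le> Re (ip (A f) (A (A f))) * Re (ip f (A f))"
      by (rule pos_op_Cauchy_Schwarz[OF A_pos Af f])
    also have "\<dots> \<le> (nrm ip (A f))\<^sup>2 * (nrm ip f)\<^sup>2"
      using A_form[OF f] A_form[OF Af] pos_opD[OF A_pos] f by (intro mult_mono) auto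
    finally have le: "(nrm ip (A f))\<^sup>2 * (nrm ip (A f))\<^sup>2 \<le> (nrm ip (A f))\<^sup>2 * (nrm ip f)\<^sup>2"
      using Af by (simp add: ip_self_eq norm_power power2_eq_square[of "(nrm ip (A f))\<^sup>2"])
    show ?thesis
    proof (cases "nrm ip (A f) = 0")
      case True
      then show ?thesis using f by simp
    next
      case False
      then have "(nrm ip (A f))\<^sup>2 \<le> (nrm ip f)\<^sup>2"
        by (intro mult_left_le_imp_le[OF le]) simp
      then show ?thesis
        using f by (auto intro: power2_le_imp_le)
    qed
  qed
  obtain Q where Q: "pos_op Q" "\<And>f. f \<in> X \<Longrightarrow> Q (Q f) = f - A f"
    "\<And>T. sym_op T \<Longrightarrow> commute T A \<Longrightarrow> commute T Q"
    using ex_sqrt_one_minus[OF A A_le] by blast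
  define c where "c = complex_of_real (sqrt C)"
  define U where "U f = c *\<^sub>C Q f" for f
  have Q_sym: "sym_op Q"
    using Q(1) by simp
  have Q_mem: "Q f \<in> X" if "f \<in> X" for f
    using sym_op_mem[OF Q_sym that] .
  have "pos_op U"
    using Q_mem sym_opD[OF Q_sym] pos_opD[OF Q(1)] C
    by (auto simp: pos_op_def sym_op_def U_def c_def ip_simps)
  moreover have "U (U f) = R f" if f: "f \<in> X" for f
  proof -
    have "U (U f) = (c * c) *\<^sub>C (f - A f)"
      using f Q_mem by (simp add: U_def sym_op_scale[OF Q_sym] Q(2) scaleC_scaleC)
    also have "c * c = of_real C"
      using C by (simp add: c_def of_real_mult[symmetric])
    also have "f - A f = complex_of_real (1 / C) *\<^sub>C R f"
      by (simp add: A_def)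
    finally show ?thesis
      using C by (simp add: scaleC_scaleC scaleC_one)
  qed
  moreover have "commute T U" if T: "sym_op T" and TR: "commute T R" for T
  proof -
    have "commute T A"
      using TR R_mem T by (simp add: commute_def A_def sym_op_diff sym_op_scale)
    then have "commute T Q"
      using Q(3) T by blast
    then show ?thesis
      using T Q_mem by (simp add: commute_def U_def sym_op_scale)
  qed
  ultimately show thesis
    using that by blast
qed

text \<open>Two roots are not known to commute with each other, but each commutes with
  \<open>R\<close>, hence with the root \<open>Q\<close> from the series, and each is compared with
  \<open>Q\<close>. For \<open>x = T f - Q f\<close> one has \<open>T x + Q x = 0\<close>; both
  forms vanish at \<open>x\<close> by positivity, so \<open>T x = Q x = 0\<close>, and then
  \<open>ip x x = ip f (T x - Q x) = 0\<close>.\<close>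

theorem pos_sqrt_unique:
  assumes T: "pos_op T" "pos_op U" and R: "pos_op R" "bounded_op R"
    and TT: "\<And>f. f \<in> X \<Longrightarrow> T (T f) = R f" and UU: "\<And>f. f \<in> X \<Longrightarrow> U (U f) = R f"
    and f: "f \<in> X"
  shows "T f = U f"
proof -
  obtain Q where Q: "pos_op Q" "\<And>f. f \<in> X \<Longrightarrow> Q (Q f) = R f"
    "\<And>T. sym_op T \<Longrightarrow> commute T R \<Longrightarrow> commute T Q"
    using ex_pos_sqrt[OF R] by blast
  have "T f = Q f" if T: "pos_op T" and TT: "\<And>f. f \<in> X \<Longrightarrow> T (T f) = R f" for T
  proof -
    have S: "sym_op T" "sym_op Q"
      using T Q by auto
    note mem = sym_op_mem[OF S(1)] sym_op_mem[OF S(2)]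
    have "commute T R"
      using TT mem by (simp add: commute_def flip: TT)
    then have TQ: "T (Q g) = Q (T g)" if "g \<in> X" for g
      using Q(3)[OF S(1)] that by (simp add: commute_def)
    define x where "x = T f - Q f"
    have x: "x \<in> X"
      using f mem by (simp add: x_def)
    have "T x + Q x = 0"
      using f mem by (simp add: x_def sym_op_diff[OF S(1)] sym_op_diff[OF S(2)] TT Q(2) TQ)
    then have "Re (ip x (T x)) + Re (ip x (Q x)) = 0"
      using x mem by (metis ip_add_right ip_zero_right plus_complex.sel(1) zero_complex.sel(1))
    then have "Re (ip x (T x)) = 0" "Re (ip x (Q x)) = 0"
      using pos_opD[OF T x] pos_opD[OF Q(1) x] by auto
    then have "T x = 0" "Q x = 0"
      using pos_op_eq_zero T Q(1) x by blast+
    then have "ip x x = 0"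
      using f mem x sym_opD[OF S(1) f x] sym_opD[OF S(2) f x]
      by (subst x_def) (simp add: ip_diff_left)
    then have "x = 0"
      using ip_pos[OF x] by fastforce
    then show ?thesis
      by (simp add: x_def)
  qed
  then show ?thesis
    using assms by metis
qed

section \<open>Dense ranges, powers and the operator square root\<close>

lemma dense_in_iff:
  "dense_in X ip D \<longleftrightarrow> D \<subseteq> X \<and> (\<forall>f\<in>X. \<forall>e>0. \<exists>d\<in>D. nrm ip (d - f) < e)"
proof (intro iffI conjI ballI allI impI)
  assume D: "dense_in X ip D"
  then show "D \<subseteq> X"
    by (simp add: dense_in_def)
  fix f e assume "f \<in> X" "(0 :: real) < e"
  then obtain s where s: "\<And>j. s j \<in> D" "(\<lambda>j. nrm ip (s j - f)) \<longlonglongrightarrow> 0"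
    using D unfolding dense_in_def lim_in_def by blast
  then have "\<forall>\<^sub>F j in sequentially. nrm ip (s j - f) < e"
    using order_tendstoD(2) \<open>0 < e\<close> by blast
  then show "\<exists>d\<in>D. nrm ip (d - f) < e"
    using s(1) by (auto simp: eventually_sequentially)
next
  assume D: "D \<subseteq> X \<and> (\<forall>f\<in>X. \<forall>e>0. \<exists>d\<in>D. nrm ip (d - f) < e)"
  have "\<exists>s. (\<forall>j. s j \<in> D) \<and> lim_in ip s f" if f: "f \<in> X" for f
  proof -
    have "\<forall>j. \<exists>d. d \<in> D \<and> nrm ip (d - f) < inverse (real (Suc j))"
      using D f by (meson inverse_positive_iff_positive of_nat_0_less_iff zero_less_Suc)
    then obtain s where s: "\<And>j. s j \<in> D" "\<And>j. nrm ip (s j - f) < inverse (real (Suc j))"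
      by metis
    have "(\<lambda>j. nrm ip (s j - f)) \<longlonglongrightarrow> 0"
    proof (rule real_tendsto_sandwich[OF _ _ tendsto_const LIMSEQ_inverse_real_of_nat])
      show "\<forall>\<^sub>F j in sequentially. 0 \<le> nrm ip (s j - f)"
        using s(1) D f by (intro always_eventually allI nrm_nonneg diff_mem) auto
      show "\<forall>\<^sub>F j in sequentially. nrm ip (s j - f) \<le> inverse (real (Suc j))"
        using s(2) by (intro always_eventually allI less_imp_le)
    qed
    with s(1) show ?thesis
      by (auto simp: lim_in_def)
  qed
  with D show "dense_in X ip D"
    by (simp add: dense_in_def)
qed

lemma dense_in_refl: "dense_in X ip X"
  by (force simp: dense_in_iff)

text \<open>It provides the dense domain that self-adjointness of the inverse of
  \<open>Q ^^ n\<close> requires.\<close>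

lemma dense_in_funpow:
  assumes Q: "sym_op Q" "bounded_op Q" and dense: "dense_in X ip (Q ` X)"
  shows "dense_in X ip ((Q ^^ n) ` X)"
proof (induction n)
  case 0
  then show ?case
    by (simp add: dense_in_refl)
next
  case (Suc n)
  obtain C0 where C0: "\<And>f. f \<in> X \<Longrightarrow> nrm ip (Q f) \<le> C0 * nrm ip f"
    using Q(2) by (auto simp: bounded_op_def)
  define C where "C = max C0 1"
  have C: "C > 0"
    by (simp add: C_def)
  have Q_le: "nrm ip (Q f) \<le> C * nrm ip f" if "f \<in> X" for f
    using C0[OF that] mult_right_mono[of C0 C "nrm ip f"] that by (simp add: C_def)
  have mem: "(Q ^^ k) f \<in> X" if "f \<in> X" for k f
    using sym_op_mem[OF sym_op_funpow[OF Q(1)] that] .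
  have "\<exists>d\<in>(Q ^^ Suc n) ` X. nrm ip (d - f) < e" if f: "f \<in> X" and e: "0 < e" for f e
  proof -
    obtain g where g: "g \<in> X" "nrm ip (Q g - f) < e / 2"
      using dense f e unfolding dense_in_iff by (metis half_gt_zero imageE)
    obtain h where h: "h \<in> X" "nrm ip ((Q ^^ n) h - g) < e / (2 * C)"
      using Suc g(1) e C unfolding dense_in_iff
      by (metis (no_types) divide_pos_pos imageE mult_pos_pos zero_less_numeral)
    have "nrm ip (Q ((Q ^^ n) h) - Q g) = nrm ip (Q ((Q ^^ n) h - g))"
      using sym_op_diff[OF Q(1) mem[OF h(1)] g(1)] by simp
    also have "\<dots> \<le> C * nrm ip ((Q ^^ n) h - g)"
      using mem h(1) g(1) by (intro Q_le) auto
    also have "\<dots> < C * (e / (2 * C))"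
      using h(2) C by (intro mult_strict_left_mono)
    also have "\<dots> = e / 2"
      using C by simp
    finally have "nrm ip ((Q ^^ Suc n) h - f) < e"
      using nrm_diff_triangle[of "(Q ^^ Suc n) h" "Q g" f] mem[of h "Suc n"] sym_op_mem[OF Q(1) g(1)] h(1) f g(2)
      by simp
    with h(1) show ?thesis
      by blast
  qed
  then show ?case
    using mem[of _ "Suc n"] unfolding dense_in_iff by blast
qed

lemma pos_op_square: "sym_op T \<Longrightarrow> pos_op (\<lambda>f. T (T f))"
  unfolding pos_op_def sym_op_def by (metis ip_self_nonneg)

lemma bounded_op_if_square:
  assumes T: "sym_op T" and bdd: "bounded_op (\<lambda>f. T (T f))"
  shows "bounded_op T"
proof -
  obtain C where C: "\<And>f. f \<in> X \<Longrightarrow> nrm ip (T (T f)) \<le> C * nrm ip f"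
    using bdd by (auto simp: bounded_op_def)
  \<comment> \<open>Since \<open>D\<close> is at least 1 and at least \<open>C\<close>, also
    \<open>C \<le> D * D\<close>; this avoids taking a square root of \<open>C\<close>.\<close>
  define D where "D = 1 + \<bar>C\<bar>"
  have "nrm ip (T f) \<le> D * nrm ip f" if f: "f \<in> X" for f
  proof (rule power2_le_imp_le)
    have Tf: "T f \<in> X" "T (T f) \<in> X"
      using sym_op_mem[OF T] f by auto
    have "(nrm ip (T f))\<^sup>2 = Re (ip f (T (T f)))"
      using arg_cong[OF ip_self_eq[OF Tf(1)], of Re] sym_opD[OF T f Tf(1)] by simp
    also have "\<dots> \<le> nrm ip f * nrm ip (T (T f))"
      using Cauchy_Schwarz[OF f Tf(2)] complex_Re_le_cmod order_trans by blast
    also have "\<dots> \<le> nrm ip f * (C * nrm ip f)"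
      using C[OF f] f by (intro mult_left_mono) auto
    also have "\<dots> = C * (nrm ip f)\<^sup>2"
      by (simp add: power2_eq_square)
    also have "\<dots> \<le> D\<^sup>2 * (nrm ip f)\<^sup>2"
    proof (rule mult_right_mono)
      have "C \<le> D"
        by (simp add: D_def)
      also have "\<dots> \<le> D\<^sup>2"
        by (rule self_le_power) (simp_all add: D_def)
      finally show "C \<le> D\<^sup>2" .
    qed simp
    finally show "(nrm ip (T f))\<^sup>2 \<le> (D * nrm ip f)\<^sup>2"
      by (simp add: power_mult_distrib)
    show "0 \<le> D * nrm ip f"
      using f by (simp add: D_def)
  qed
  then show ?thesis
    by (auto simp: bounded_op_def)
qed

text \<open>Half of the factors are moved to the left argument; what remains is the squared norm of
  \<open>(T ^^ k) f\<close> for even \<open>n\<close> and the form of \<open>T\<close> at that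
  vector for odd \<open>n\<close>.\<close>

lemma pos_op_funpow:
  assumes T: "pos_op T"
  shows "pos_op (T ^^ n)"
proof -
  have S: "sym_op T"
    using T by simp
  have mem: "(T ^^ k) f \<in> X" if "f \<in> X" for k f
    using sym_op_mem[OF sym_op_funpow[OF S] that] .
  have "0 \<le> Re (ip f ((T ^^ n) f))" if f: "f \<in> X" for f
  proof (cases "even n")
    case True
    then obtain k where "n = k + k"
      by (metis evenE mult_2)
    then have "ip f ((T ^^ n) f) = ip ((T ^^ k) f) ((T ^^ k) f)"
      using sym_opD[OF sym_op_funpow[OF S] f mem[OF f], of k k] by (simp add: funpow_add)
    then show ?thesis
      using ip_self_nonneg[OF mem[OF f]] by simp
  next
    case False
    then obtain k where "n = k + Suc k"
      by (metis add_Suc_right add.right_neutral mult_2 oddE add_Suc One_nat_def)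
    then have "ip f ((T ^^ n) f) = ip ((T ^^ k) f) (T ((T ^^ k) f))"
      using sym_opD[OF sym_op_funpow[OF S] f mem[OF f], of k "Suc k"] by (simp add: funpow_add funpow_swap1)
    then show ?thesis
      using pos_opD[OF T mem[OF f]] by simp
  qed
  then show ?thesis
    using S sym_op_funpow by (simp add: pos_op_def)
qed

lemma bounded_op_funpow:
  assumes "sym_op T" "bounded_op T"
  shows "bounded_op (T ^^ n)"
proof (induction n)
  case 0
  show ?case
    by (auto simp: bounded_op_def intro: exI[of _ 1])
next
  case (Suc n)
  obtain C D where C: "\<And>f. f \<in> X \<Longrightarrow> nrm ip (T f) \<le> C * nrm ip f"
    and D: "\<And>f. f \<in> X \<Longrightarrow> nrm ip ((T ^^ n) f) \<le> D * nrm ip f"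
    using Suc assms(2) by (auto simp: bounded_op_def)
  have "nrm ip ((T ^^ Suc n) f) \<le> (\<bar>C\<bar> * D) * nrm ip f" if f: "f \<in> X" for f
  proof -
    have Tf: "(T ^^ n) f \<in> X"
      using sym_op_mem[OF sym_op_funpow[OF assms(1)] f] .
    have "nrm ip ((T ^^ Suc n) f) \<le> C * nrm ip ((T ^^ n) f)"
      using C[OF Tf] by simp
    also have "\<dots> \<le> \<bar>C\<bar> * nrm ip ((T ^^ n) f)"
      using Tf by (intro mult_right_mono) auto
    also have "\<dots> \<le> \<bar>C\<bar> * (D * nrm ip f)"
      using D[OF f] by (intro mult_left_mono) auto
    finally show ?thesis
      by simp
  qed
  then show ?case
    by (auto simp: bounded_op_def)
qed

text \<open>A relation whose square is defined everywhere is itself defined everywhere, and symmetry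
  then forces single-valuedness. So \<open>W\<close> is the graph of a positive operator, to which
  uniqueness of bounded roots applies. Only symmetry and positivity of the pairs are assumed, so
  that \<open>W\<close> may also be the converse of an unbounded root.\<close>

lemma sqrt_graph_unique:
  assumes T: "pos_op T" and bdd: "bounded_op (\<lambda>f. T (T f))"
    and W: "W \<subseteq> X \<times> X" "W O W = {(f, T (T f)) | f. f \<in> X}"
    and sym: "\<And>f g u v. (f, g) \<in> W \<Longrightarrow> (u, v) \<in> W \<Longrightarrow> ip f v = ip g u"
    and pos: "\<And>f g. (f, g) \<in> W \<Longrightarrow> 0 \<le> Re (ip f g)"
  shows "W = {(f, T f) | f. f \<in> X}"
proof -
  have total: "\<exists>g. (f, g) \<in> W" if "f \<in> X" for f
  proof -
    have "(f, T (T f)) \<in> W O W"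
      using that W(2) by blast
    then show ?thesis
      by blast
  qed
  have single: "g = g'" if g: "(f, g) \<in> W" "(f, g') \<in> W" for f g g'
  proof (rule eq_by_ip)
    fix h assume "h \<in> X"
    then obtain v where "(h, v) \<in> W"
      using total by blast
    then show "ip h g = ip h g'"
      using sym g by metis
  qed (use g W in auto)
  obtain t where t: "\<And>f. f \<in> X \<Longrightarrow> (f, t f) \<in> W"
    using total by metis
  have t_mem: "t f \<in> X" if "f \<in> X" for f
    using t[OF that] W(1) by auto
  have "pos_op t"
    unfolding pos_op_def sym_op_def using t_mem t sym pos by metis
  moreover have "t (t f) = T (T f)" if f: "f \<in> X" for f
  proof -
    have "(f, t (t f)) \<in> W O W"
      using t[OF f] t[OF t_mem[OF f]] by blast
    then show ?thesis
      unfolding W(2) by simp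
  qed
  ultimately have "t f = T f" if "f \<in> X" for f
    using pos_sqrt_unique[OF _ T pos_op_square bdd _ _ that] T by simp
  then have T: "(f, T f) \<in> W" if "f \<in> X" for f
    using t that by metis
  show ?thesis
    using T single[OF _ T] W(1) by auto
qed

text \<open>It resolves the definite description for everywhere defined operators, whose graphs
  equal their adjoints by symmetry.\<close>

lemma op_sqrt_bounded:
  assumes T: "pos_op T" and bdd: "bounded_op (\<lambda>f. T (T f))"
  shows "op_sqrt X ip {(f, T (T f)) | f. f \<in> X} = {(f, T f) | f. f \<in> X}"
  unfolding op_sqrt_def
proof (rule the_equality)
  have S: "sym_op T"
    using T by simp
  note mem = sym_op_mem[OF S]
  have "adjoint X ip {(f, T f) | f. f \<in> X} = {(f, T f) | f. f \<in> X}"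
  proof (intro equalityI subrelI)
    fix f g assume "(f, g) \<in> adjoint X ip {(f, T f) | f. f \<in> X}"
    then have f: "f \<in> X" "g \<in> X" and *: "\<And>u. u \<in> X \<Longrightarrow> ip f (T u) = ip g u"
      by (auto simp: adjoint_def)
    have "g = T f"
    proof (rule eq_by_ip)
      fix h assume h: "h \<in> X"
      have "ip g h = ip (T f) h"
        using *[OF h] sym_opD[OF S f(1) h] by simp
      then show "ip h g = ip h (T f)"
        using ip_cnj[OF f(2) h] ip_cnj[OF mem[OF f(1)] h] by simp
    qed (use f mem in auto)
    with f show "(f, g) \<in> {(f, T f) | f. f \<in> X}"
      by blast
  next
    fix f g assume "(f, g) \<in> {(f, T f) | f. f \<in> X}"
    then show "(f, g) \<in> adjoint X ip {(f, T f) | f. f \<in> X}"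
      using mem sym_opD[OF S] by (auto simp: adjoint_def)
  qed
  moreover have "Domain {(f, T f) | f. f \<in> X} = X"
    by auto
  ultimately show "selfadjoint X ip {(f, T f) | f. f \<in> X} \<and> bounded_below_by ip 0 {(f, T f) | f. f \<in> X} \<and>
      {(f, T f) | f. f \<in> X} O {(f, T f) | f. f \<in> X} = {(f, T (T f)) | f. f \<in> X}"
    using mem pos_opD[OF T] dense_in_refl
    by (auto simp: selfadjoint_def bounded_below_by_def single_valued_def)
  fix W assume W: "selfadjoint X ip W \<and> bounded_below_by ip 0 W \<and> W O W = {(f, T (T f)) | f. f \<in> X}"
  then have adj: "adjoint X ip W = W"
    by (simp add: selfadjoint_def)
  show "W = {(f, T f) | f. f \<in> X}"
  proof (rule sqrt_graph_unique[OF T bdd])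
    show "W \<subseteq> X \<times> X" "W O W = {(f, T (T f)) | f. f \<in> X}"
      using W by (auto simp: selfadjoint_def)
    show "ip f v = ip g u" if "(f, g) \<in> W" "(u, v) \<in> W" for f g u v
    proof -
      have "(f, g) \<in> adjoint X ip W"
        using that adj by simp
      with that show ?thesis
        by (auto simp: adjoint_def)
    qed
    show "0 \<le> Re (ip f g)" if "(f, g) \<in> W" for f g
      using W that by (auto simp: bounded_below_by_def)
  qed
qed

text \<open>The converse of a root of the inverse of \<open>T\<close> squared is a root of
  \<open>T\<close> squared, so uniqueness reduces to the bounded case. Injectivity makes the
  converse graph of \<open>T\<close> single-valued and the dense range gives it a dense
  domain.\<close>

lemma op_sqrt_inverse:
  assumes T: "pos_op T" and bdd: "bounded_op (\<lambda>f. T (T f))"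
    and inj: "inj_on T X" and dense: "dense_in X ip (T ` X)"
  shows "op_sqrt X ip {(T (T f), f) | f. f \<in> X} = {(T f, f) | f. f \<in> X}"
  unfolding op_sqrt_def
proof (rule the_equality)
  have S: "sym_op T"
    using T by simp
  note mem = sym_op_mem[OF S]
  have "adjoint X ip {(T f, f) | f. f \<in> X} = {(T f, f) | f. f \<in> X}"
  proof (intro equalityI subrelI)
    fix f g assume "(f, g) \<in> adjoint X ip {(T f, f) | f. f \<in> X}"
    then have f: "f \<in> X" "g \<in> X" and *: "\<And>u. u \<in> X \<Longrightarrow> ip f u = ip g (T u)"
      by (auto simp: adjoint_def)
    have "f = T g"
    proof (rule eq_by_ip)
      fix h assume h: "h \<in> X"
      have "ip f h = ip (T g) h"
        using *[OF h] sym_opD[OF S f(2) h] by simp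
      then show "ip h f = ip h (T g)"
        using ip_cnj[OF f(1) h] ip_cnj[OF mem[OF f(2)] h] by simp
    qed (use f mem in auto)
    with f show "(f, g) \<in> {(T f, f) | f. f \<in> X}"
      by blast
  next
    fix f g assume "(f, g) \<in> {(T f, f) | f. f \<in> X}"
    then show "(f, g) \<in> adjoint X ip {(T f, f) | f. f \<in> X}"
      using mem sym_opD[OF S] by (auto simp: adjoint_def)
  qed
  moreover have "Domain {(T f, f) | f. f \<in> X} = T ` X"
    by auto
  moreover have "single_valued {(T f, f) | f. f \<in> X}"
    using inj by (auto simp: single_valued_def inj_on_def)
  moreover have "{(T f, f) | f. f \<in> X} O {(T f, f) | f. f \<in> X} = {(T (T f), f) | f. f \<in> X}"
    using mem by blast
  moreover have "0 \<le> Re (ip (T f) f)" if "f \<in> X" for f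
    using pos_opD[OF T that] sym_opD[OF S that that] by simp
  ultimately show "selfadjoint X ip {(T f, f) | f. f \<in> X} \<and> bounded_below_by ip 0 {(T f, f) | f. f \<in> X} \<and>
      {(T f, f) | f. f \<in> X} O {(T f, f) | f. f \<in> X} = {(T (T f), f) | f. f \<in> X}"
    using mem dense by (simp add: selfadjoint_def bounded_below_by_def) blast
  fix W assume W: "selfadjoint X ip W \<and> bounded_below_by ip 0 W \<and> W O W = {(T (T f), f) | f. f \<in> X}"
  then have adj: "adjoint X ip W = W"
    by (simp add: selfadjoint_def)
  have "W\<inverse> = {(f, T f) | f. f \<in> X}"
  proof (rule sqrt_graph_unique[OF T bdd])
    show W_sub: "W\<inverse> \<subseteq> X \<times> X"
      using W by (auto simp: selfadjoint_def)
    have "W\<inverse> O W\<inverse> = (W O W)\<inverse>"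
      by blast
    then show "W\<inverse> O W\<inverse> = {(f, T (T f)) | f. f \<in> X}"
      using W by auto
    show "ip f v = ip g u" if "(f, g) \<in> W\<inverse>" "(u, v) \<in> W\<inverse>" for f g u v
    proof -
      have "(g, f) \<in> adjoint X ip W"
        using that adj by simp
      with that show ?thesis
        by (auto simp: adjoint_def)
    qed
    show "0 \<le> Re (ip f g)" if "(f, g) \<in> W\<inverse>" for f g
    proof -
      have "0 \<le> Re (ip g f)" "f \<in> X" "g \<in> X"
        using W that W_sub by (auto simp: bounded_below_by_def)
      then show ?thesis
        using ip_cnj[of f g] by simp
    qed
  qed
  then show "W = {(T f, f) | f. f \<in> X}"
    by (auto simp: set_eq_iff)
qed

end

section \<open>The scale in terms of the inverse square root\<close>

lemma shiftI: "(f, g) \<in> A \<Longrightarrow> (f, g - z *\<^sub>C f) \<in> shift A z"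
  by (auto simp: shift_def)

lemma app_eqI: "(f, g) \<in> A \<Longrightarrow> (\<And>g'. (f, g') \<in> A \<Longrightarrow> g' = g) \<Longrightarrow> app A f = g"
  unfolding app_def by (rule the_equality)

lemma app_mem: "\<exists>!g. (f, g) \<in> A \<Longrightarrow> (f, app A f) \<in> A"
  unfolding app_def by (rule theI')

context hilbert_scale
begin

sublocale H: hilbert_space "Hsp S n" "Hip S n" for n
  by (rule hilbert)

text \<open>The inverse square root \<open>(L - z\<^sub>1)\<^sup>-\<^sup>1\<^sup>/\<^sup>2\<close>, a bounded operator in \<open>Hsp S 0\<close>.\<close>

definition is_inv_half :: "('a \<Rightarrow> 'a) \<Rightarrow> bool" where
  "is_inv_half Q \<longleftrightarrow> H.pos_op 0 Q \<and> H.bounded_op 0 Q \<and> inj_on Q (Hsp S 0) \<and>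
     dense_in (Hsp S 0) (Hip S 0) (Q ` Hsp S 0) \<and>
     shift (Lop S) (of_real (base_pt S)) = {(Q (Q g), g) | g. g \<in> Hsp S 0} \<and>
     (\<forall>T. H.sym_op 0 T \<longrightarrow> H.commute 0 T (\<lambda>g. Q (Q g)) \<longrightarrow> H.commute 0 T Q)"

definition inv_half :: "'a \<Rightarrow> 'a" where
  "inv_half = (SOME Q. is_inv_half Q)"

text \<open>Self-adjointness and the lower bound at the base point make L - z1 symmetric and
  nonnegative; the base point being in the resolvent set provides the bounded inverse
  \<open>R\<close>. Both enter the existence of the positive root of \<open>R\<close>.\<close>

lemma ex_inv_half: "\<exists>Q. is_inv_half Q"
proof -
  define \<zeta> where "\<zeta> = complex_of_real (base_pt S)"
  define X ip where "X = Hsp S 0" and "ip = Hip S 0"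
  interpret X: hilbert_space X ip
    unfolding X_def ip_def by (rule hilbert)
  define B where "B = shift (Lop S) \<zeta>"
  note sa = L_selfadjoint[folded X_def ip_def]
  have L_sub: "Lop S \<subseteq> X \<times> X" and L_sv: "single_valued (Lop S)"
    and L_dense: "dense_in X ip (Domain (Lop S))" and L_adj: "adjoint X ip (Lop S) = Lop S"
    using sa by (auto simp: selfadjoint_def)
  have B_iff: "(f, g) \<in> B \<longleftrightarrow> (f, g + \<zeta> *\<^sub>C f) \<in> Lop S" for f g
    by (force simp: B_def shift_def)
  have B_sub: "f \<in> X \<and> g \<in> X" if "(f, g) \<in> B" for f g
  proof -
    have "f \<in> X" "g + \<zeta> *\<^sub>C f \<in> X"
      using that L_sub by (auto simp: B_iff)
    then show ?thesis
      using X.diff_mem[of "g + \<zeta> *\<^sub>C f" "\<zeta> *\<^sub>C f"] by simp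
  qed
  have B_sv: "g = g'" if "(f, g) \<in> B" "(f, g') \<in> B" for f g g'
    using that L_sv by (force simp: B_iff single_valued_def)
  have B_sym: "ip f v = ip g u" if "(f, g) \<in> B" "(u, v) \<in> B" for f g u v
  proof -
    have "(f, g + \<zeta> *\<^sub>C f) \<in> adjoint X ip (Lop S)" "(u, v + \<zeta> *\<^sub>C u) \<in> Lop S"
      using that L_adj by (auto simp: B_iff)
    then have "ip f (v + \<zeta> *\<^sub>C u) = ip (g + \<zeta> *\<^sub>C f) u"
      by (auto simp: adjoint_def)
    then show ?thesis
      using B_sub[OF that(1)] B_sub[OF that(2)] by (simp add: X.ip_simps \<zeta>_def)
  qed
  have B_pos: "0 \<le> Re (ip f g)" if "(f, g) \<in> B" for f g
  proof -
    have "base_pt S * Re (ip f f) \<le> Re (ip f (g + \<zeta> *\<^sub>C f))"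
      using base_below that unfolding B_iff bounded_below_by_def ip_def by blast
    then show ?thesis
      using B_sub[OF that] by (simp add: X.ip_simps \<zeta>_def)
  qed
  have res: "\<zeta> \<in> resolvent_set X ip (Lop S)"
    using base_res by (simp add: X_def ip_def \<zeta>_def)
  define R where "R g = (THE f. (f, g) \<in> B)" for g
  have B_unique: "\<exists>!f. (f, g) \<in> B" if "g \<in> X" for g
    using res that by (auto simp: resolvent_set_def B_def)
  have R: "(R g, g) \<in> B" if "g \<in> X" for g
    unfolding R_def using B_unique[OF that] by (rule theI')
  have R_eq: "f = R g" if "(f, g) \<in> B" for f g
    using that R B_unique B_sub by blast
  have R_mem: "R g \<in> X" if "g \<in> X" for g
    using R[OF that] B_sub by blast
  have R_inj: "f = g" if "f \<in> X" "g \<in> X" "R f = R g" for f g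
    using R[OF that(1)] R[OF that(2)] that(3) B_sv by metis
  have R_pos: "X.pos_op R"
    unfolding X.pos_op_def X.sym_op_def
  proof (intro conjI ballI)
    fix f assume f: "f \<in> X"
    have "Re (ip f (R f)) = Re (ip (R f) f)"
      using X.ip_cnj[OF f R_mem[OF f]] by simp
    then show "0 \<le> Re (ip f (R f))"
      using B_pos[OF R[OF f]] by simp
  qed (use R_mem B_sym R in auto)
  obtain C where C: "\<And>f g. (f, g) \<in> B \<Longrightarrow> nrm ip f \<le> C * nrm ip g"
    using res unfolding resolvent_set_def B_def by blast
  have R_bdd: "X.bounded_op R"
    using C R by (auto simp: X.bounded_op_def)
  obtain Q where Q: "X.pos_op Q" "\<And>f. f \<in> X \<Longrightarrow> Q (Q f) = R f"
    "\<And>T. X.sym_op T \<Longrightarrow> X.commute T R \<Longrightarrow> X.commute T Q"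
    using X.ex_pos_sqrt[OF R_pos R_bdd] by blast
  have Q_mem: "Q f \<in> X" if "f \<in> X" for f
    using X.sym_op_mem[OF X.pos_op_sym[OF Q(1)] that] .
  have "X.bounded_op Q"
    using R_bdd Q(2) by (intro X.bounded_op_if_square[OF X.pos_op_sym[OF Q(1)]]) (simp add: X.bounded_op_def)
  moreover have "inj_on Q X"
    using R_inj Q(2) by (metis inj_onI)
  \<comment> \<open>The domain of L is the range of \<open>R\<close>, and the range of
    \<open>Q\<close> contains it because \<open>R\<close> is \<open>Q\<close> applied twice.\<close>
  moreover have "dense_in X ip (Q ` X)"
  proof -
    have "f \<in> Q ` X" if fg: "(f, g) \<in> Lop S" for f g
    proof -
      have B: "(f, g - \<zeta> *\<^sub>C f) \<in> B"
        using fg by (simp add: B_iff)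
      then have "f = Q (Q (g - \<zeta> *\<^sub>C f))"
        using R_eq Q(2) B_sub by simp
      then show ?thesis
        using Q_mem B_sub[OF B] by blast
    qed
    then have "Domain (Lop S) \<subseteq> Q ` X"
      by blast
    moreover have "Q ` X \<subseteq> X"
      using Q_mem by blast
    ultimately show ?thesis
      using dense_in_mono[OF L_dense] by blast
  qed
  moreover have "B = {(Q (Q g), g) | g. g \<in> X}"
  proof (intro equalityI subrelI)
    fix f g assume fg: "(f, g) \<in> B"
    then have "g \<in> X" "f = Q (Q g)"
      using B_sub R_eq Q(2) by metis+
    then show "(f, g) \<in> {(Q (Q g), g) | g. g \<in> X}"
      by blast
  next
    fix f g assume "(f, g) \<in> {(Q (Q g), g) | g. g \<in> X}"
    then show "(f, g) \<in> B"
      using R Q(2) by auto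
  qed
  moreover have "X.commute T Q" if "X.sym_op T" "X.commute T (\<lambda>g. Q (Q g))" for T
  proof -
    have "X.commute T R"
      using that(2) X.sym_op_mem[OF that(1)] by (simp add: X.commute_def Q(2))
    then show ?thesis
      using Q(3)[OF that(1)] by blast
  qed
  ultimately have "is_inv_half Q"
    using Q(1) unfolding is_inv_half_def B_def \<zeta>_def X_def ip_def by blast
  then show ?thesis
    by blast
qed

lemma inv_half: "is_inv_half inv_half"
  unfolding inv_half_def using ex_inv_half by (rule someI_ex)

lemma inv_half_pos: "H.pos_op 0 inv_half"
  and inv_half_bounded: "H.bounded_op 0 inv_half"
  and inv_half_inj: "inj_on inv_half (Hsp S 0)"
  and inv_half_dense: "dense_in (Hsp S 0) (Hip S 0) (inv_half ` Hsp S 0)"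
  and shift_L_eq: "shift (Lop S) (of_real (base_pt S)) = {(inv_half (inv_half g), g) | g. g \<in> Hsp S 0}"
  and inv_half_commute: "H.sym_op 0 T \<Longrightarrow> H.commute 0 T (\<lambda>g. inv_half (inv_half g)) \<Longrightarrow> H.commute 0 T inv_half"
  using inv_half by (simp_all add: is_inv_half_def)

lemma inv_half_sym: "H.sym_op 0 inv_half"
  using inv_half_pos by (rule H.pos_op_sym)

section \<open>Powers of the inverse square root and the spaces H_n\<close>

lemma root_pos: "H.pos_op 0 (inv_half ^^ n)"
  using inv_half_pos by (rule H.pos_op_funpow)

lemma root_sym: "H.sym_op 0 (inv_half ^^ n)"
  using root_pos by (rule H.pos_op_sym)

lemma root_mem [intro, simp]: "g \<in> Hsp S 0 \<Longrightarrow> (inv_half ^^ n) g \<in> Hsp S 0"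
  using root_sym by (rule H.sym_op_mem)

lemma inv_half_mem [intro, simp]: "g \<in> Hsp S 0 \<Longrightarrow> inv_half g \<in> Hsp S 0"
  using inv_half_sym by (rule H.sym_op_mem)

lemma root_diff: "f \<in> Hsp S 0 \<Longrightarrow> g \<in> Hsp S 0 \<Longrightarrow>
    (inv_half ^^ n) f - (inv_half ^^ n) g = (inv_half ^^ n) (f - g)"
  using H.sym_op_diff[OF root_sym] by simp

lemma root_inj: "inj_on (inv_half ^^ n) (Hsp S 0)"
proof (induction n)
  case (Suc n)
  have "inj_on inv_half ((inv_half ^^ n) ` Hsp S 0)"
    using inv_half_inj by (rule inj_on_subset) auto
  with Suc show ?case
    using comp_inj_on by (simp only: funpow.simps)
qed simp

lemma root_bounded: "H.bounded_op 0 (\<lambda>f. (inv_half ^^ n) ((inv_half ^^ n) f))"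
  using H.bounded_op_funpow[OF inv_half_sym inv_half_bounded, of "n + n"]
  by (simp add: funpow_add comp_def)

lemma root_dense: "dense_in (Hsp S 0) (Hip S 0) ((inv_half ^^ n) ` Hsp S 0)"
  by (rule H.dense_in_funpow[OF inv_half_sym inv_half_bounded inv_half_dense])

text \<open>Parametrising the graph by its second component replaces powers of an unbounded operator
  by powers of an everywhere defined map.\<close>

lemma b_op_nat: "b_op S (int n) = {((inv_half ^^ n) ((inv_half ^^ n) g), g) | g. g \<in> Hsp S 0}"
proof -
  have "Id_on (Hsp S 0) O shift (Lop S) (of_real (base_pt S)) ^^ n =
      {((inv_half ^^ (n + n)) g, g) | g. g \<in> Hsp S 0}"
  proof (induction n)
    case (Suc n)
    have "Id_on (Hsp S 0) O shift (Lop S) (of_real (base_pt S)) ^^ Suc n =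
        {((inv_half ^^ (n + n)) g, g) | g. g \<in> Hsp S 0} O {(inv_half (inv_half g), g) | g. g \<in> Hsp S 0}"
      unfolding relpow.simps O_assoc[symmetric] Suc by (simp only: shift_L_eq)
    also have "\<dots> = {((inv_half ^^ (n + n)) (inv_half (inv_half g)), g) | g. g \<in> Hsp S 0}"
      by blast
    finally show ?case
      by (simp add: funpow_swap1)
  qed (auto simp: Id_on_def)
  then show ?thesis
    by (simp add: b_op_def funpow_add)
qed

lemma b_op_minus_nat: "b_op S (- int n) = {(g, (inv_half ^^ n) ((inv_half ^^ n) g)) | g. g \<in> Hsp S 0}"
\<comment> \<open>For \<open>n = 0\<close> the index is not negative, so \<open>b_op\<close> uses
  its other branch.\<close>
proof (cases "n = 0")
  case True
  then show ?thesis
    using b_op_nat[of 0] by simp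
next
  case False
  have conv: "(shift (Lop S) (of_real (base_pt S)))\<inverse> = {(g, inv_half (inv_half g)) | g. g \<in> Hsp S 0}"
    by (auto simp: shift_L_eq)
  have "Id_on (Hsp S 0) O (shift (Lop S) (of_real (base_pt S)))\<inverse> ^^ n =
      {(g, (inv_half ^^ (n + n)) g) | g. g \<in> Hsp S 0}"
  proof (induction n)
    case (Suc n)
    have "Id_on (Hsp S 0) O (shift (Lop S) (of_real (base_pt S)))\<inverse> ^^ Suc n =
        {(g, (inv_half ^^ (n + n)) g) | g. g \<in> Hsp S 0} O {(g, inv_half (inv_half g)) | g. g \<in> Hsp S 0}"
      unfolding relpow.simps O_assoc[symmetric] Suc by (simp only: conv)
    also have "\<dots> = {(g, inv_half (inv_half ((inv_half ^^ (n + n)) g))) | g. g \<in> Hsp S 0}"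
      using root_mem by blast
    finally show ?case
      by simp
  qed (auto simp: Id_on_def)
  then show ?thesis
    using False by (simp add: b_op_def funpow_add)
qed

lemma b_half_nat: "b_half S (int n) = {((inv_half ^^ n) g, g) | g. g \<in> Hsp S 0}"
  unfolding b_half_def b_op_nat
  by (rule H.op_sqrt_inverse[OF root_pos root_bounded root_inj root_dense])

lemma b_half_minus_nat: "b_half S (- int n) = {(g, (inv_half ^^ n) g) | g. g \<in> Hsp S 0}"
  unfolding b_half_def b_op_minus_nat
  by (rule H.op_sqrt_bounded[OF root_pos root_bounded])

lemma app_b_half_nat: "g \<in> Hsp S 0 \<Longrightarrow> app (b_half S (int n)) ((inv_half ^^ n) g) = g"
  by (rule app_eqI) (use inj_onD[OF root_inj[of n]] in \<open>auto simp: b_half_nat\<close>)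

lemma app_b_half_minus_nat: "g \<in> Hsp S 0 \<Longrightarrow> app (b_half S (- int n)) g = (inv_half ^^ n) g"
  by (rule app_eqI) (auto simp: b_half_minus_nat)

lemma Hsp_nat: "Hsp S (int n) = (inv_half ^^ n) ` Hsp S 0"
  using nonneg_space[of "int n"] by (auto simp: b_half_nat)

text \<open>Together with \<open>Hsp_nat\<close> this makes \<open>inv_half ^^ n\<close> a unitary
  map from H_0 onto H_n; later computations in H_n are pulled back along it.\<close>

lemma Hip_nat: "\<lbrakk>f \<in> Hsp S 0; g \<in> Hsp S 0\<rbrakk> \<Longrightarrow>
    Hip S (int n) ((inv_half ^^ n) f) ((inv_half ^^ n) g) = Hip S 0 f g"
  using nonneg_ip[of "int n" "(inv_half ^^ n) f" "(inv_half ^^ n) g"]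
  by (simp add: Hsp_nat app_b_half_nat)

lemma nrm_nat: "f \<in> Hsp S 0 \<Longrightarrow> nrm (Hip S (int n)) ((inv_half ^^ n) f) = nrm (Hip S 0) f"
  by (simp add: nrm_def Hip_nat)

lemma nrm_minus_nat: "f \<in> Hsp S 0 \<Longrightarrow> nrm (Hip S (- int n)) f = nrm (Hip S 0) ((inv_half ^^ n) f)"
  by (cases "n = 0") (simp_all add: nrm_def neg_ip app_b_half_minus_nat)

lemma Hsp_antimono: "k \<le> n \<Longrightarrow> Hsp S n \<subseteq> Hsp S k"
proof (induction n rule: int_ge_induct)
  case (step n)
  then show ?case
    using incl[of n] by blast
qed simp

lemma Hsp_0_dense_minus_nat: "dense_in (Hsp S (- int n)) (Hip S (- int n)) (Hsp S 0)"
  using neg_dense[of "- int n"] H.dense_in_refl[of 0] by (cases "n = 0") auto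

section \<open>Extension by continuity and the unitary maps\<close>

lemma extend_converse: "extend S l k (A\<inverse>) = (extend S k l A)\<inverse>"
proof -
  have "extend S l k (A\<inverse>) \<subseteq> (extend S k l A)\<inverse>" for k l A
    by (auto simp: extend_def)
  from this[of l k A] this[of k l "A\<inverse>"] show ?thesis
    by auto
qed

text \<open>Isometry turns an approximating sequence into a Cauchy sequence of images, and it forces
  two approximations of the same vector to have images with the same limit. With
  \<open>extend_converse\<close> the same argument covers inverse maps.\<close>

lemma extend_ex1:
  assumes dense: "dense_in (Hsp S k) (Hip S k) (Domain (A \<inter> Hsp S k \<times> Hsp S l))"
    and iso: "\<And>f g f' g'. (f, g) \<in> A \<inter> Hsp S k \<times> Hsp S l \<Longrightarrow> (f', g') \<in> A \<inter> Hsp S k \<times> Hsp S l \<Longrightarrow>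
        nrm (Hip S l) (g - g') = nrm (Hip S k) (f - f')"
    and f: "f \<in> Hsp S k"
  shows "\<exists>!g. (f, g) \<in> extend S k l A"
proof (rule ex_ex1I)
  obtain s where s: "\<And>j. s j \<in> Domain (A \<inter> Hsp S k \<times> Hsp S l)" "lim_in (Hip S k) s f"
    using dense f unfolding dense_in_def by blast
  then have "\<forall>j. \<exists>g. (s j, g) \<in> A \<inter> Hsp S k \<times> Hsp S l"
    by blast
  then obtain t where st: "\<And>j. (s j, t j) \<in> A \<inter> Hsp S k \<times> Hsp S l"
    by metis
  have mem: "s j \<in> Hsp S k" "t j \<in> Hsp S l" for j
    using st by auto
  have "\<exists>N. \<forall>i\<ge>N. \<forall>j\<ge>N. nrm (Hip S l) (t i - t j) < e" if "0 < e" for e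
    using H.lim_imp_Cauchy[OF s(2) mem(1) f that] iso[OF st st] by simp
  then obtain g where "g \<in> Hsp S l" "lim_in (Hip S l) t g"
    using H.complete[of t l] mem by blast
  then show "\<exists>g. (f, g) \<in> extend S k l A"
    using f s(2) st unfolding extend_def by blast
next
  fix g g' assume "(f, g) \<in> extend S k l A" "(f, g') \<in> extend S k l A"
  then obtain s t s' t' where g: "g \<in> Hsp S l" "g' \<in> Hsp S l"
    and st: "\<And>j. (s j, t j) \<in> A \<inter> Hsp S k \<times> Hsp S l" "\<And>j. (s' j, t' j) \<in> A \<inter> Hsp S k \<times> Hsp S l"
    and lim: "lim_in (Hip S k) s f" "lim_in (Hip S k) s' f" "lim_in (Hip S l) t g" "lim_in (Hip S l) t' g'"
    unfolding extend_def by blast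
  have mem: "s j \<in> Hsp S k" "t j \<in> Hsp S l" "s' j \<in> Hsp S k" "t' j \<in> Hsp S l" for j
    using st by auto
  have lim_diff: "(\<lambda>j. nrm (Hip S k) (s j - f) + nrm (Hip S k) (s' j - f) + nrm (Hip S l) (t' j - g')) \<longlonglongrightarrow> 0 + 0 + 0"
    using lim unfolding lim_in_def by (intro tendsto_add)
  have "lim_in (Hip S l) t g'"
    unfolding lim_in_def
  proof (rule real_tendsto_sandwich[OF _ _ tendsto_const lim_diff[simplified]])
    show "\<forall>\<^sub>F j in sequentially. 0 \<le> nrm (Hip S l) (t j - g')"
      using mem g by (intro always_eventually allI H.nrm_nonneg H.diff_mem)
    have "nrm (Hip S l) (t j - g') \<le> nrm (Hip S k) (s j - f) + nrm (Hip S k) (s' j - f) + nrm (Hip S l) (t' j - g')" for j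
      using H.nrm_diff_triangle[OF mem(2)[of j] mem(4)[of j] g(2)] iso[OF st(1)[of j] st(2)[of j]]
        H.nrm_diff_triangle[OF mem(1)[of j] f mem(3)[of j]] H.nrm_minus_commute[OF f mem(3)[of j]]
      by simp
    then show "\<forall>\<^sub>F j in sequentially. nrm (Hip S l) (t j - g') \<le>
        nrm (Hip S k) (s j - f) + nrm (Hip S k) (s' j - f) + nrm (Hip S l) (t' j - g')"
      by (intro always_eventually allI)
  qed
  then show "g = g'"
    using H.lim_unique[OF lim(3) _ mem(2) g] by blast
qed

lemma extend_mem:
  assumes "(f, g) \<in> A \<inter> Hsp S k \<times> Hsp S l"
  shows "(f, g) \<in> extend S k l A"
proof -
  have "f \<in> Hsp S k" "g \<in> Hsp S l"
    using assms by auto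
  moreover have "\<exists>s t. (\<forall>j. (s j, t j) \<in> A \<inter> Hsp S k \<times> Hsp S l) \<and>
      lim_in (Hip S k) s f \<and> lim_in (Hip S l) t g"
    by (rule exI[of _ "\<lambda>_. f"], rule exI[of _ "\<lambda>_. g"]) (use assms in \<open>simp add: H.lim_const\<close>)
  ultimately show ?thesis
    by (simp add: extend_def)
qed

lemma b_unitary_0_eq: "b_unitary S (int n) 0 = extend S 0 (- int n) {((inv_half ^^ n) g, g) | g. g \<in> Hsp S 0}"
  by (simp add: b_unitary_def b_half_nat)

lemma Hsp_0_subset_minus_nat: "Hsp S 0 \<subseteq> Hsp S (- int n)"
  by (rule Hsp_antimono) simp

lemma root_graph_restrict:
  "{((inv_half ^^ n) g, g) | g. g \<in> Hsp S 0} \<inter> Hsp S 0 \<times> Hsp S (- int n) = {((inv_half ^^ n) g, g) | g. g \<in> Hsp S 0}"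
  using Hsp_0_subset_minus_nat by auto

text \<open>The pairs \<open>((inv_half ^^ n) g, g)\<close> are isometric from H_0 to H_{-n}, since
  the norm of \<open>g\<close> in H_{-n} is that of \<open>(inv_half ^^ n) g\<close> in H_0; their
  first components are dense in H_0.\<close>

lemma b_unitary_0_ex1:
  assumes "f \<in> Hsp S 0"
  shows "\<exists>!g. (f, g) \<in> b_unitary S (int n) 0"
  unfolding b_unitary_0_eq
proof (rule extend_ex1, unfold root_graph_restrict)
  have "Domain {((inv_half ^^ n) g, g) | g. g \<in> Hsp S 0} = (inv_half ^^ n) ` Hsp S 0"
    by auto
  then show "dense_in (Hsp S 0) (Hip S 0) (Domain {((inv_half ^^ n) g, g) | g. g \<in> Hsp S 0})"
    using root_dense by simp
qed (use assms in \<open>auto simp: nrm_minus_nat root_diff\<close>)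

lemma b_unitary_0_converse_ex1:
  assumes "g \<in> Hsp S (- int n)"
  shows "\<exists>!f. (g, f) \<in> (b_unitary S (int n) 0)\<inverse>"
  unfolding b_unitary_0_eq extend_converse[symmetric]
proof (rule extend_ex1)
  let ?A = "{((inv_half ^^ n) g, g) | g. g \<in> Hsp S 0}"
  have eq: "?A\<inverse> \<inter> Hsp S (- int n) \<times> Hsp S 0 = ?A\<inverse>"
    using root_graph_restrict[of n] by blast
  have "Domain (?A\<inverse>) = Hsp S 0"
    by auto
  then show "dense_in (Hsp S (- int n)) (Hip S (- int n)) (Domain (?A\<inverse> \<inter> Hsp S (- int n) \<times> Hsp S 0))"
    unfolding eq using Hsp_0_dense_minus_nat by simp
qed (use assms in \<open>auto simp: nrm_minus_nat root_diff\<close>)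

lemma app_b_unitary_0: "f \<in> Hsp S 0 \<Longrightarrow> (f, app (b_unitary S (int n) 0) f) \<in> b_unitary S (int n) 0"
  by (rule app_mem) (rule b_unitary_0_ex1)

lemma app_b_unitary_0_converse_mem:
  "g \<in> Hsp S (- int n) \<Longrightarrow> app ((b_unitary S (int n) 0)\<inverse>) g \<in> Hsp S 0"
  using app_mem[OF b_unitary_0_converse_ex1] by (auto simp: b_unitary_0_eq extend_def)

lemma app_b_unitary_0_converse_app:
  assumes "f \<in> Hsp S 0"
  shows "app ((b_unitary S (int n) 0)\<inverse>) (app (b_unitary S (int n) 0) f) = f"
proof (rule app_eqI)
  note mem = app_b_unitary_0[OF assms, of n]
  then show "(app (b_unitary S (int n) 0) f, f) \<in> (b_unitary S (int n) 0)\<inverse>"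
    by simp
  have "app (b_unitary S (int n) 0) f \<in> Hsp S (- int n)"
    using mem by (auto simp: b_unitary_0_eq extend_def)
  then show "f' = f" if "(app (b_unitary S (int n) 0) f, f') \<in> (b_unitary S (int n) 0)\<inverse>" for f'
    using b_unitary_0_converse_ex1 that mem by blast
qed

lemma b_unitary_self_eq:
  "b_unitary S (int n) (int n) = extend S (int n) 0 {((inv_half ^^ n) g, g) | g. g \<in> Hsp S 0}"
  by (simp add: b_unitary_def b_half_nat)

lemma root_graph_restrict_self:
  "{((inv_half ^^ n) g, g) | g. g \<in> Hsp S 0} \<inter> Hsp S (int n) \<times> Hsp S 0 = {((inv_half ^^ n) g, g) | g. g \<in> Hsp S 0}"
  by (auto simp: Hsp_nat)

lemma b_unitary_self_mem:
  assumes "g \<in> Hsp S 0"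
  shows "((inv_half ^^ n) g, g) \<in> b_unitary S (int n) (int n)"
proof -
  have "((inv_half ^^ n) g, g) \<in> {((inv_half ^^ n) g, g) | g. g \<in> Hsp S 0} \<inter> Hsp S (int n) \<times> Hsp S 0"
    using assms unfolding root_graph_restrict_self by blast
  then show ?thesis
    unfolding b_unitary_self_eq by (rule extend_mem)
qed

text \<open>The half power is already defined on all of H_n, and by isometry the extension adds no
  second value.\<close>

lemma app_b_unitary_self:
  assumes g: "g \<in> Hsp S 0"
  shows "app (b_unitary S (int n) (int n)) ((inv_half ^^ n) g) = g"
proof (rule app_eqI[OF b_unitary_self_mem[OF g]])
  let ?A = "{((inv_half ^^ n) g, g) | g. g \<in> Hsp S 0}"
  have "\<exists>!g'. ((inv_half ^^ n) g, g') \<in> b_unitary S (int n) (int n)"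
    unfolding b_unitary_self_eq
  proof (rule extend_ex1, unfold root_graph_restrict_self)
    have "Domain ?A = Hsp S (int n)"
      by (auto simp: Hsp_nat)
    then show "dense_in (Hsp S (int n)) (Hip S (int n)) (Domain ?A)"
      using H.dense_in_refl by simp
  qed (use g in \<open>auto simp: Hsp_nat nrm_nat root_diff\<close>)
  then show "g' = g" if "((inv_half ^^ n) g, g') \<in> b_unitary S (int n) (int n)" for g'
    using that b_unitary_self_mem[OF g] by blast
qed

lemma app_b_unitary_self_converse:
  assumes g: "g \<in> Hsp S 0"
  shows "app ((b_unitary S (int n) (int n))\<inverse>) g = (inv_half ^^ n) g"
proof (rule app_eqI)
  show "(g, (inv_half ^^ n) g) \<in> (b_unitary S (int n) (int n))\<inverse>"
    using b_unitary_self_mem[OF g] by simp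
  let ?A = "{((inv_half ^^ n) g, g) | g. g \<in> Hsp S 0}"
  have "\<exists>!f. (g, f) \<in> (b_unitary S (int n) (int n))\<inverse>"
    unfolding b_unitary_self_eq extend_converse[symmetric]
  proof (rule extend_ex1)
    have eq: "?A\<inverse> \<inter> Hsp S 0 \<times> Hsp S (int n) = ?A\<inverse>"
      using root_graph_restrict_self[of n] by blast
    have "Domain (?A\<inverse>) = Hsp S 0"
      by auto
    then show "dense_in (Hsp S 0) (Hip S 0) (Domain (?A\<inverse> \<inter> Hsp S 0 \<times> Hsp S (int n)))"
      unfolding eq using H.dense_in_refl by simp
  qed (use g in \<open>auto simp: Hsp_nat nrm_nat root_diff\<close>)
  then show "f = (inv_half ^^ n) g" if "(g, f) \<in> (b_unitary S (int n) (int n))\<inverse>" for f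
    using that b_unitary_self_mem[OF g] by blast
qed

section \<open>Regularity of the resolvent and of the vectors h\<close>

lemma L_iff: "(f, g) \<in> Lop S \<longleftrightarrow>
    (\<exists>u\<in>Hsp S 0. f = inv_half (inv_half u) \<and> g = u + of_real (base_pt S) *\<^sub>C f)"
proof -
  have "(f, g) \<in> Lop S \<longleftrightarrow> (f, g - of_real (base_pt S) *\<^sub>C f) \<in> shift (Lop S) (of_real (base_pt S))"
    by (force simp: shift_def)
  then show ?thesis
    by (auto simp: shift_L_eq algebra_simps)
qed

text \<open>A bootstrap: \<open>u = (L - z1) f = h + (z - z1) f\<close> is as regular as the worse
  of \<open>h\<close> and \<open>f\<close>, while \<open>f\<close> is two steps more regular than
  \<open>u\<close>. Starting from H_0 this climbs until the regularity of \<open>h\<close> is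
  exhausted.\<close>

lemma resolvent_regular:
  assumes fh: "(f, h) \<in> shift (Lop S) z" and h: "h \<in> Hsp S (int m)"
  shows "f \<in> Hsp S (int m + 2)"
proof -
  have "(f, h + z *\<^sub>C f) \<in> Lop S"
    using fh by (auto simp: shift_def)
  then obtain u where u: "u \<in> Hsp S 0" "f = inv_half (inv_half u)"
    and hu: "h + z *\<^sub>C f = u + of_real (base_pt S) *\<^sub>C f"
    unfolding L_iff by blast
  have u_eq: "u = h + z *\<^sub>C f - of_real (base_pt S) *\<^sub>C f"
    using hu by simp
  have step: "f \<in> Hsp S (int j + 2)" if "j \<le> m" "f \<in> Hsp S (int j)" for j
  proof -
    have "h \<in> Hsp S (int j)"
      using h Hsp_antimono[of "int j" "int m"] that by auto
    then have "u \<in> Hsp S (int j)"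
      unfolding u_eq using that by (intro H.diff_mem H.add_mem H.scale_mem)
    then obtain w where w: "w \<in> Hsp S 0" "u = (inv_half ^^ j) w"
      by (auto simp: Hsp_nat)
    have "f = (inv_half ^^ (j + 2)) w"
      unfolding u(2) w(2) by simp
    then have "f \<in> Hsp S (int (j + 2))"
      using w(1) unfolding Hsp_nat by blast
    then show ?thesis
      by (simp add: add.commute)
  qed
  have "j \<le> m \<Longrightarrow> f \<in> Hsp S (int j)" for j
  proof (induction j)
    case 0
    then show ?case
      using u by simp
  next
    case (Suc j)
    then show ?case
      using step[of j] Hsp_antimono[of "int (Suc j)" "int j + 2"] by auto
  qed
  then show ?thesis
    using step by blast
qed

text \<open>The 2m + 2 factors of the inverse of b_{m+1} are split as m and m + 2 instead of evenly:
  the inner m + 2 factors are isometric from H_{-m-2} to H_0, the outer m factors from H_0 to H_m.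
  So the extension to H_{-m-2} exists and takes values in H_m.\<close>

lemma h_vec_mem:
  assumes "\<phi> \<sigma> \<in> Hsp S (- int m - 2)"
  shows "h_vec S m \<phi> \<sigma> \<in> Hsp S (int m)"
proof -
  define A where "A = {(g, (inv_half ^^ m) ((inv_half ^^ (m + 2)) g)) | g. g \<in> Hsp S 0}"
  have "(inv_half ^^ Suc m) ((inv_half ^^ Suc m) g) = (inv_half ^^ m) ((inv_half ^^ (m + 2)) g)" for g
    by (simp add: funpow_swap1)
  then have A: "(b_op S (int m + 1))\<inverse> = A"
    using b_op_nat[of "Suc m"] unfolding A_def by (auto simp: add.commute)
  have neg: "- int m - 2 = - int (m + 2)"
    by simp
  have restrict: "A \<inter> Hsp S (- int (m + 2)) \<times> Hsp S (int m) = A"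
    using Hsp_0_subset_minus_nat[of "m + 2"] by (auto simp: A_def Hsp_nat)
  have "\<exists>!h. (\<phi> \<sigma>, h) \<in> extend S (- int (m + 2)) (int m) A"
  proof (rule extend_ex1, unfold restrict)
    have "Domain A = Hsp S 0"
      by (auto simp: A_def)
    then show "dense_in (Hsp S (- int (m + 2))) (Hip S (- int (m + 2))) (Domain A)"
      using Hsp_0_dense_minus_nat by (simp only:)
    show "nrm (Hip S (int m)) (g - g') = nrm (Hip S (- int (m + 2))) (f - f')"
      if "(f, g) \<in> A" "(f', g') \<in> A" for f g f' g'
      using that unfolding A_def
      by (auto simp only: mem_Collect_eq prod.inject root_diff root_mem nrm_nat nrm_minus_nat H.diff_mem)
  qed (use assms in \<open>simp only: neg\<close>)
  then have "(\<phi> \<sigma>, h_vec S m \<phi> \<sigma>) \<in> extend S (- int (m + 2)) (int m) A"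
    unfolding h_vec_def A neg by (rule app_mem)
  then show ?thesis
    by (simp add: extend_def)
qed

end

section \<open>Compatible projections\<close>

text \<open>The axioms hold for the minus and for the plus projections alike, so whatever is proved
  here serves both.\<close>

locale compatible_projections = hilbert_scale S
  for S :: "'a::complex_vector hscale" +
  fixes P :: "int \<Rightarrow> 'a \<Rightarrow> 'a"
  assumes proj: "orth_proj (Hsp S n) (Hip S n) (P n)"
    and compatible: "f \<in> Hsp S (n + 1) \<Longrightarrow> P n f = P (n + 1) f"
begin

lemma P_sym: "H.sym_op n (P n)"
  using proj[of n] by (simp add: orth_proj_def H.sym_op_def)

lemma P_mem: "f \<in> Hsp S n \<Longrightarrow> P n f \<in> Hsp S n"
  using P_sym by (rule H.sym_op_mem)

lemma P_idem: "f \<in> Hsp S n \<Longrightarrow> P n (P n f) = P n f"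
  using proj[of n] by (simp add: orth_proj_def)

lemma P_nat_eq: "f \<in> Hsp S (int n) \<Longrightarrow> P (int n) f = P 0 f"
proof (induction n)
  case (Suc n)
  then have "f \<in> Hsp S (int n + 1)"
    by (simp add: add.commute)
  then show ?case
    using compatible[of f "int n"] incl[of "int n"] Suc.IH by (auto simp: add.commute)
qed simp

text \<open>Symmetry of the projection in both \<open>Hsp S 0\<close> and \<open>Hsp S 1\<close> makes it commute with the
  operator \<open>(L - z\<^sub>1)\<^sup>-\<^sup>1\<close>, whose form relates the two inner products.\<close>

lemma P_commute_inv_half: "a \<in> Hsp S 0 \<Longrightarrow> P 0 (inv_half a) = inv_half (P 0 a)"
proof -
  have sym0: "Hip S 0 (P 0 f) g = Hip S 0 f (P 0 g)" if "f \<in> Hsp S 0" "g \<in> Hsp S 0" for f g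
    using H.sym_opD[OF P_sym that] .
  have Hip_1: "Hip S 1 (inv_half f) (inv_half g) = Hip S 0 f g" if "f \<in> Hsp S 0" "g \<in> Hsp S 0" for f g
    using Hip_nat[OF that, of 1] by simp
  have Hsp_1: "Hsp S 1 = inv_half ` Hsp S 0" and Hsp_2: "Hsp S 2 = (\<lambda>f. inv_half (inv_half f)) ` Hsp S 0"
    using Hsp_nat[of 1] Hsp_nat[of 2] by (simp_all add: numeral_2_eq_2 comp_def)
  have P_1: "P 1 f = P 0 f" if "f \<in> Hsp S 1" for f
    using P_nat_eq[of f 1] that by simp
  have P_2: "P 2 f = P 0 f" if "f \<in> Hsp S 2" for f
    using P_nat_eq[of f 2] that by simp
  have square: "P 0 (inv_half (inv_half a)) = inv_half (inv_half (P 0 a))" if a: "a \<in> Hsp S 0" for a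
  proof -
    \<comment> \<open>H_2 is invariant under \<open>P 2\<close>, which yields a candidate
      \<open>c\<close> for \<open>P 0 a\<close>; what remains is to identify it.\<close>
    have "P 2 (inv_half (inv_half a)) \<in> Hsp S 2"
      using a by (intro P_mem) (auto simp: Hsp_2)
    then obtain c where c: "c \<in> Hsp S 0" "P 0 (inv_half (inv_half a)) = inv_half (inv_half c)"
      using P_2[of "inv_half (inv_half a)"] a by (auto simp: Hsp_2)
    \<comment> \<open>Tested against \<open>v\<close>, the left-hand side is an inner product in
      H_1. The projection is moved across it in H_1, and after returning to H_0 it is moved back
      there.\<close>
    have "inv_half c = inv_half (P 0 a)"
    proof (rule H.eq_by_ip)
      fix v assume v: "v \<in> Hsp S 0"
      have in1: "inv_half (inv_half a) \<in> Hsp S 1" "inv_half v \<in> Hsp S 1"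
        using a v by (auto simp: Hsp_1)
      then have "P 1 (inv_half v) \<in> Hsp S 1"
        by (intro P_mem)
      then obtain w where w: "w \<in> Hsp S 0" "P 0 (inv_half v) = inv_half w"
        using in1 by (auto simp: Hsp_1 P_1)
      have "Hip S 0 v (inv_half c) = Hip S 1 (inv_half v) (inv_half (inv_half c))"
        using c v by (simp add: Hip_1)
      also have "\<dots> = Hip S 1 (inv_half w) (inv_half (inv_half a))"
        using H.sym_opD[OF P_sym in1(2,1)] in1 c w by (simp add: P_1)
      also have "\<dots> = Hip S 0 w (inv_half a)"
        using a w by (simp add: Hip_1)
      also have "\<dots> = Hip S 0 (P 0 (inv_half v)) a"
        using a w H.sym_opD[OF inv_half_sym w(1) a] by simp
      also have "\<dots> = Hip S 0 v (inv_half (P 0 a))"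
        using a v sym0[of "inv_half v" a] H.sym_opD[OF inv_half_sym v P_mem[OF a]] by simp
      finally show "Hip S 0 v (inv_half c) = Hip S 0 v (inv_half (P 0 a))" .
    qed (use a c P_mem in auto)
    then show ?thesis
      using c by simp
  qed
  then have "H.commute 0 (P 0) inv_half"
    by (intro inv_half_commute P_sym) (simp add: H.commute_def)
  then show "a \<in> Hsp S 0 \<Longrightarrow> P 0 (inv_half a) = inv_half (P 0 a)"
    by (simp add: H.commute_def)
qed

lemma P_commute_root: "a \<in> Hsp S 0 \<Longrightarrow> P 0 ((inv_half ^^ n) a) = (inv_half ^^ n) (P 0 a)"
  by (induction n) (simp_all add: P_commute_inv_half)

lemma P_zero_eq:
  assumes "f \<in> Hsp S 0"
  shows "P_zero S m P f = P 0 f"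
proof -
  have "P (int m) ((inv_half ^^ m) f) = (inv_half ^^ m) (P 0 f)"
    using assms by (simp add: P_nat_eq Hsp_nat P_commute_root)
  then show ?thesis
    using assms P_mem by (simp add: P_zero_def app_b_unitary_self app_b_unitary_self_converse)
qed

text \<open>\<open>P 0\<close> commutes with \<open>inv_half\<close>, so it maps the graph of L into
  itself, and \<open>(P 0 f, P 0 h)\<close> solves the resolvent equation of the part. The solution
  is unique because the part is a restriction of L and \<open>z\<close> is in the resolvent set of
  L.\<close>

lemma L_part_resolvent:
  assumes z: "z \<in> resolvent_set (Hsp S 0) (Hip S 0) (Lop S)"
    and fh: "(f, h) \<in> shift (Lop S) z" and h: "h \<in> Hsp S (int m)"
  shows "app ((shift (L_part S m P) z)\<inverse>) (P (int m) h) = P 0 f"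
proof (rule app_eqI)
  have f2: "f \<in> Hsp S (int (m + 2))"
    using resolvent_regular[OF fh h] by (simp add: add.commute)
  have fm: "f \<in> Hsp S (int m)"
    using f2 Hsp_antimono[of "int m" "int (m + 2)"] by auto
  have mem0: "f \<in> Hsp S 0" "h \<in> Hsp S 0"
    using fm h Hsp_antimono[of 0 "int m"] by auto
  have L: "(f, h + z *\<^sub>C f) \<in> Lop S"
    using fh by (auto simp: shift_def)
  then obtain u where u: "u \<in> Hsp S 0" "f = inv_half (inv_half u)"
    and hu: "h + z *\<^sub>C f = u + of_real (base_pt S) *\<^sub>C f"
    unfolding L_iff by blast
  note P_add = H.sym_op_add[OF P_sym[of 0]] and P_scale = H.sym_op_scale[OF P_sym[of 0]]
  have "P 0 f = inv_half (inv_half (P 0 u))"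
    using u by (simp add: P_commute_inv_half)
  moreover have "P 0 (h + z *\<^sub>C f) = P 0 u + of_real (base_pt S) *\<^sub>C P 0 f"
    unfolding hu using u mem0 by (simp add: P_add P_scale)
  ultimately have "(P 0 f, P 0 (h + z *\<^sub>C f)) \<in> Lop S"
    unfolding L_iff using u P_mem by blast
  moreover have "P 0 f \<in> Hsp S (int m + 2)"
    using P_mem[OF f2] P_nat_eq[OF f2] by (simp add: add.commute)
  moreover have "P 0 f \<in> P (int m) ` Hsp S (int m)"
    by (rule rev_image_eqI[OF fm]) (simp add: P_nat_eq[OF fm])
  moreover have "P 0 (h + z *\<^sub>C f) \<in> P (int m) ` Hsp S (int m)"
  proof -
    have "h + z *\<^sub>C f \<in> Hsp S (int m)"
      using h fm by simp
    then show ?thesis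
      by (rule rev_image_eqI) (simp add: P_nat_eq \<open>h + z *\<^sub>C f \<in> Hsp S (int m)\<close>)
  qed
  ultimately have "(P 0 f, P 0 (h + z *\<^sub>C f)) \<in> L_part S m P"
    by (simp add: L_part_def L_on_def)
  note shiftI[OF this, of z]
  moreover have "P 0 (h + z *\<^sub>C f) - z *\<^sub>C P 0 f = P (int m) h"
    using mem0 by (simp add: P_add P_scale P_nat_eq[OF h])
  ultimately have "(P 0 f, P (int m) h) \<in> shift (L_part S m P) z"
    by simp
  then show mem: "(P (int m) h, P 0 f) \<in> (shift (L_part S m P) z)\<inverse>"
    by simp
  have sub: "shift (L_part S m P) z \<subseteq> shift (Lop S) z"
    by (auto simp: shift_def L_part_def L_on_def)
  have "P (int m) h \<in> Hsp S 0"
    unfolding P_nat_eq[OF h] using mem0(2) by (rule P_mem)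
  then have "\<exists>!f'. (f', P (int m) h) \<in> shift (Lop S) z"
    using z by (simp add: resolvent_set_def)
  then show "f' = P 0 f" if "(P (int m) h, f') \<in> (shift (L_part S m P) z)\<inverse>" for f'
    using that mem sub by blast
qed

end

section \<open>Matrix entries of the Weyl functions\<close>

context hilbert_scale
begin

text \<open>The family \<open>P\<close> is quantified after \<open>x\<close> and \<open>y\<close>
  are obtained, so the same vectors serve both projections. They are the preimages of the
  functionals under the half power b_{m+2}^(1/2) and the images under it of the resolvent applied to
  \<open>h_vec\<close>.\<close>

lemma weyl_vectors:
  assumes z: "z \<in> resolvent_set (Hsp S 0) (Hip S 0) (Lop S)"
    and \<phi>: "\<And>\<sigma>. \<phi> \<sigma> \<in> Hsp S (- int m - 2)"
  obtains x y where "\<And>\<sigma>. x \<sigma> \<in> Hsp S 0" "\<And>\<sigma>. y \<sigma> \<in> Hsp S 0"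
    "\<And>\<sigma> \<sigma>'. q S m \<phi> z $ \<sigma> $ \<sigma>' = (z - of_real (base_pt S)) * Hip S 0 (x \<sigma>) (y \<sigma>')"
    "\<And>P \<sigma> \<sigma>'. compatible_projections S P \<Longrightarrow>
      q_part S m P \<phi> z $ \<sigma> $ \<sigma>' = (z - of_real (base_pt S)) * Hip S 0 (x \<sigma>) (P 0 (y \<sigma>'))"
proof -
  define x where "x \<sigma> = app ((b_unitary S (int m + 2) 0)\<inverse>) (\<phi> \<sigma>)" for \<sigma>
  define f where "f \<sigma> = app ((shift (Lop S) z)\<inverse>) (h_vec S m \<phi> \<sigma>)" for \<sigma>
  have int2: "int m + 2 = int (m + 2)"
    by simp
  have x: "x \<sigma> \<in> Hsp S 0" for \<sigma>
  proof -
    have "- int (m + 2) = - int m - 2"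
      by simp
    then have "\<phi> \<sigma> \<in> Hsp S (- int (m + 2))"
      using \<phi>[of \<sigma>] by (simp only:)
    then show ?thesis
      unfolding x_def int2 by (rule app_b_unitary_0_converse_mem)
  qed
  have h: "h_vec S m \<phi> \<sigma> \<in> Hsp S (int m)" for \<sigma>
    using \<phi> by (rule h_vec_mem)
  have fh: "(f \<sigma>, h_vec S m \<phi> \<sigma>) \<in> shift (Lop S) z" for \<sigma>
  proof -
    have "h_vec S m \<phi> \<sigma> \<in> Hsp S 0"
      using h Hsp_antimono[of 0 "int m"] by auto
    then have "\<exists>!f. (h_vec S m \<phi> \<sigma>, f) \<in> (shift (Lop S) z)\<inverse>"
      using z by (simp add: resolvent_set_def)
    from app_mem[OF this] show ?thesis
      unfolding f_def by simp
  qed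
  have "f \<sigma> \<in> Hsp S (int (m + 2))" for \<sigma>
    using resolvent_regular[OF fh h] unfolding int2 .
  then have "\<forall>\<sigma>. \<exists>u\<in>Hsp S 0. f \<sigma> = (inv_half ^^ (m + 2)) u"
    unfolding Hsp_nat by blast
  then obtain y where y: "\<And>\<sigma>. y \<sigma> \<in> Hsp S 0" and fy: "\<And>\<sigma>. f \<sigma> = (inv_half ^^ (m + 2)) (y \<sigma>)"
    by metis
  have pairing: "pairing S m \<psi> ((inv_half ^^ (m + 2)) u) = Hip S 0 (app ((b_unitary S (int m + 2) 0)\<inverse>) \<psi>) u"
    if "u \<in> Hsp S 0" for \<psi> u
    by (simp only: pairing_def int2 app_b_unitary_self[OF that])
  show thesis
  proof (rule that[of x y, OF x y])
    show "q S m \<phi> z $ \<sigma> $ \<sigma>' = (z - of_real (base_pt S)) * Hip S 0 (x \<sigma>) (y \<sigma>')" for \<sigma> \<sigma>'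
      by (simp only: q_def weyl_def vec_lambda_beta f_def[symmetric] fy pairing[OF y] x_def[symmetric])
    fix P \<sigma> \<sigma>' assume "compatible_projections S P"
    then interpret P: compatible_projections S P .
    have Px: "P 0 (x \<sigma>) \<in> Hsp S 0" and Py: "P 0 (y \<sigma>') \<in> Hsp S 0"
      using x y P.P_mem by auto
    have "app ((b_unitary S (int m + 2) 0)\<inverse>) (phi_part S m P \<phi> \<sigma>) = P 0 (x \<sigma>)"
      unfolding phi_part_def x_def[symmetric] P.P_zero_eq[OF x] unfolding int2
      by (rule app_b_unitary_0_converse_app[OF Px])
    moreover have "app ((shift (L_part S m P) z)\<inverse>) (P (int m) (h_vec S m \<phi> \<sigma>')) = (inv_half ^^ (m + 2)) (P 0 (y \<sigma>'))"
      unfolding P.L_part_resolvent[OF z fh h] fy by (rule P.P_commute_root[OF y])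
    ultimately have "q_part S m P \<phi> z $ \<sigma> $ \<sigma>' = (z - of_real (base_pt S)) * Hip S 0 (P 0 (x \<sigma>)) (P 0 (y \<sigma>'))"
      by (simp only: q_part_def weyl_def vec_lambda_beta pairing[OF Py])
    \<comment> \<open>Both the functional and the resolvent vector carry a projection; symmetry and
      idempotence merge the two into one.\<close>
    also have "Hip S 0 (P 0 (x \<sigma>)) (P 0 (y \<sigma>')) = Hip S 0 (x \<sigma>) (P 0 (y \<sigma>'))"
      using H.sym_opD[OF P.P_sym x Py] P.P_idem[OF y] by simp
    finally show "q_part S m P \<phi> z $ \<sigma> $ \<sigma>' = (z - of_real (base_pt S)) * Hip S 0 (x \<sigma>) (P 0 (y \<sigma>'))" .
  qed
qed

end

lemma (in compatible_projections) compatible_projections_compl: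
  "compatible_projections S (proj_compl P)"
proof unfold_locales
  fix n
  have "P n f \<in> Hsp S n" if "f \<in> Hsp S n" for f
    using that by (rule P_mem)
  then show "orth_proj (Hsp S n) (Hip S n) (proj_compl P n)"
    using proj[of n] unfolding orth_proj_def proj_compl_def
    by (auto simp: H.ip_simps complex_vector.scale_right_diff_distrib H.sym_op_diff[OF P_sym])
next
  fix f n assume "f \<in> Hsp S (n + 1)"
  then show "proj_compl P n f = proj_compl P (n + 1) f"
    by (simp add: proj_compl_def compatible)
qed

theorem mainTheorem4:
  fixes S :: "'a::complex_vector hscale"
    and m :: nat
    and \<phi> :: "'s::finite \<Rightarrow> 'a"
    and Pm :: "int \<Rightarrow> 'a \<Rightarrow> 'a"
  assumes "hilbert_scale S"
    and "\<forall>\<sigma>. \<phi> \<sigma> \<in> Hsp S (- int m - 2) - Hsp S (- int m - 1)"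
    and "inj \<phi>" and "complex_vector.independent (range \<phi>)"
    and "\<forall>n. orth_proj (Hsp S n) (Hip S n) (Pm n)"
    and "\<forall>n. \<forall>f\<in>Hsp S (n + 1). Pm n f = Pm (n + 1) f"
  shows "\<forall>z\<in>resolvent_set (Hsp S 0) (Hip S 0) (Lop S).
           q S m \<phi> z = q_part S m Pm \<phi> z + q_part S m (proj_compl Pm) \<phi> z"
proof
  fix z assume z: "z \<in> resolvent_set (Hsp S 0) (Hip S 0) (Lop S)"
  interpret hilbert_scale S
    by fact
  interpret P: compatible_projections S Pm
    using assms(5,6) by unfold_locales blast+
  obtain x y where x: "\<And>\<sigma>. x \<sigma> \<in> Hsp S 0" and y: "\<And>\<sigma>. y \<sigma> \<in> Hsp S 0"
    and q: "\<And>\<sigma> \<sigma>'. q S m \<phi> z $ \<sigma> $ \<sigma>' = (z - of_real (base_pt S)) * Hip S 0 (x \<sigma>) (y \<sigma>')"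
    and q_part: "\<And>P \<sigma> \<sigma>'. compatible_projections S P \<Longrightarrow>
      q_part S m P \<phi> z $ \<sigma> $ \<sigma>' = (z - of_real (base_pt S)) * Hip S 0 (x \<sigma>) (P 0 (y \<sigma>'))"
    using weyl_vectors[OF z] assms(2) by (metis DiffD1)
  have "Hip S 0 (x \<sigma>) (y \<sigma>') = Hip S 0 (x \<sigma>) (Pm 0 (y \<sigma>')) + Hip S 0 (x \<sigma>) (proj_compl Pm 0 (y \<sigma>'))" for \<sigma> \<sigma>'
    using x y P.P_mem by (simp add: proj_compl_def H.ip_diff_right)
  then show "q S m \<phi> z = q_part S m Pm \<phi> z + q_part S m (proj_compl Pm) \<phi> z"
    by (simp add: vec_eq_iff q q_part P.compatible_projections_axioms P.compatible_projections_compl distrib_left)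
qed

end
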